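(* Let $G$ be a compact Hausdorff topological group, let $\mathcal{B}$ be one of the categories $\mathbf{Tych}$, $\mathbf{Unif}$, $\mathbf{Comp}$, with corresponding index $s=t,u,c$ respectively, and let $\mathbb{H}^s$ be the monad on $\mathcal{B}$ given by product with $G$. Then the category $\mathcal{B}^{\mathbb{H}^s}$ of $\mathbb{H}^s$-algebras is (small) cocomplete.
   Context: $\mathbf{Tych}$: Tychonoff spaces and continuous maps. $\mathbf{Unif}$: (separated) uniform spaces and uniformly continuous maps. $\mathbf{Comp}$: compact Hausdorff spaces and continuous maps. $G$ is a fixed compact topological group (with identity $e$). The monads are $\mathbb{H}^s=(H^s,\eta^s,\mu^s)$ with $H^s(X)=G\times X$, $H^s(f)=1_G\times f$, $\eta^s_X(x)=(e,x)$, $\mu^s_X(g_1,(g_2,x))=(g_1g_2,x)$, where for $s=t,c$ the product is the topological product, and for $s=u$ one takes $H^u(X,\mathcal{U})=(G,\mathcal{U}_G)\times(X,\mathcal{U})$ with $\mathcal{U}_G$ the unique (totally bounded and complete) uniformity on $G$ inducing its topology. Thus $\mathbb{H}^s$-algebras are objects of $\mathcal{B}$ with an action $G\times X\to X$ that is a morphism of $\mathcal{B}$, and morphisms are equivariant morphisms of $\mathcal{B}$. $\mathcal{B}^{\mathbb{H}^s}$ is the Eilenberg–Moore category. *)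

theory Defs
  imports "HOL-Analysis.Analysis" "HOL-Algebra.Group"
begin

section \<open>Smallness\<close>

text \<open>
  Everything lives in a type \<open>'u\<close> that plays the role of a Grothendieck universe: a set is small
  iff it has fewer elements than \<open>'u\<close>, and \<open>universe\<close> says that the cardinality of \<open>'u\<close> is an
  infinite regular strong limit. Every uncountable such cardinal is strongly inaccessible; the
  countable one (small = finite) is not excluded.
\<close>

definition small :: "'u set \<Rightarrow> bool" where
  "small A \<longleftrightarrow> A \<prec> (UNIV :: 'u set)"

definition universe :: "'u itself \<Rightarrow> bool" where
  "universe _ \<longleftrightarrow>
     infinite (UNIV :: 'u set) \<and>
     (\<forall>A :: 'u set. small A \<longrightarrow> Pow A \<prec> (UNIV :: 'u set)) \<and>
     (\<forall>(I :: 'u set) (A :: 'u \<Rightarrow> 'u set). small I \<and> (\<forall>i\<in>I. small (A i)) \<longrightarrow> small (\<Union>i\<in>I. A i))"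


section \<open>Categories, functors, colimits\<close>

text \<open>
  Hom-sets are indexed by objects and need not be disjoint. \<open>Cmp C X Y Z g f\<close> is the composite
  of \<open>f : X \<rightarrow> Y\<close> and \<open>g : Y \<rightarrow> Z\<close>.
\<close>

record ('o, 'm) cat =
  Ob :: "'o set"
  Hom :: "'o \<Rightarrow> 'o \<Rightarrow> 'm set"
  Idn :: "'o \<Rightarrow> 'm"
  Cmp :: "'o \<Rightarrow> 'o \<Rightarrow> 'o \<Rightarrow> 'm \<Rightarrow> 'm \<Rightarrow> 'm"

definition is_category :: "('o, 'm) cat \<Rightarrow> bool" where
  "is_category C \<longleftrightarrow>
     (\<forall>X\<in>Ob C. Idn C X \<in> Hom C X X) \<and>
     (\<forall>X\<in>Ob C. \<forall>Y\<in>Ob C. \<forall>Z\<in>Ob C. \<forall>f\<in>Hom C X Y. \<forall>g\<in>Hom C Y Z.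
        Cmp C X Y Z g f \<in> Hom C X Z) \<and>
     (\<forall>X\<in>Ob C. \<forall>Y\<in>Ob C. \<forall>f\<in>Hom C X Y.
        Cmp C X X Y f (Idn C X) = f \<and> Cmp C X Y Y (Idn C Y) f = f) \<and>
     (\<forall>W\<in>Ob C. \<forall>X\<in>Ob C. \<forall>Y\<in>Ob C. \<forall>Z\<in>Ob C.
        \<forall>f\<in>Hom C W X. \<forall>g\<in>Hom C X Y. \<forall>h\<in>Hom C Y Z.
        Cmp C W X Z (Cmp C X Y Z h g) f = Cmp C W Y Z h (Cmp C W X Y g f))"

definition small_category :: "('u, 'u) cat \<Rightarrow> bool" where
  "small_category J \<longleftrightarrow>
     is_category J \<and> small (Ob J) \<and> (\<forall>i\<in>Ob J. \<forall>j\<in>Ob J. small (Hom J i j))"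

record ('o1, 'm1, 'o2, 'm2) func =
  FOb :: "'o1 \<Rightarrow> 'o2"
  FHom :: "'o1 \<Rightarrow> 'o1 \<Rightarrow> 'm1 \<Rightarrow> 'm2"

definition is_functor ::
    "('o1, 'm1) cat \<Rightarrow> ('o2, 'm2) cat \<Rightarrow> ('o1, 'm1, 'o2, 'm2, 'x) func_scheme \<Rightarrow> bool" where
  "is_functor C D F \<longleftrightarrow>
     (\<forall>X\<in>Ob C. FOb F X \<in> Ob D) \<and>
     (\<forall>X\<in>Ob C. \<forall>Y\<in>Ob C. \<forall>f\<in>Hom C X Y. FHom F X Y f \<in> Hom D (FOb F X) (FOb F Y)) \<and>
     (\<forall>X\<in>Ob C. FHom F X X (Idn C X) = Idn D (FOb F X)) \<and>
     (\<forall>X\<in>Ob C. \<forall>Y\<in>Ob C. \<forall>Z\<in>Ob C. \<forall>f\<in>Hom C X Y. \<forall>g\<in>Hom C Y Z.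
        FHom F X Z (Cmp C X Y Z g f)
          = Cmp D (FOb F X) (FOb F Y) (FOb F Z) (FHom F Y Z g) (FHom F X Y f))"

definition is_cocone ::
    "('j, 'n) cat \<Rightarrow> ('o, 'm) cat \<Rightarrow> ('j, 'n, 'o, 'm) func \<Rightarrow> 'o \<Rightarrow> ('j \<Rightarrow> 'm) \<Rightarrow> bool" where
  "is_cocone J C F L \<iota> \<longleftrightarrow>
     L \<in> Ob C \<and>
     (\<forall>j\<in>Ob J. \<iota> j \<in> Hom C (FOb F j) L) \<and>
     (\<forall>i\<in>Ob J. \<forall>j\<in>Ob J. \<forall>a\<in>Hom J i j.
        Cmp C (FOb F i) (FOb F j) L (\<iota> j) (FHom F i j a) = \<iota> i)"

definition is_colimit ::
    "('j, 'n) cat \<Rightarrow> ('o, 'm) cat \<Rightarrow> ('j, 'n, 'o, 'm) func \<Rightarrow> 'o \<Rightarrow> ('j \<Rightarrow> 'm) \<Rightarrow> bool" where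
  "is_colimit J C F L \<iota> \<longleftrightarrow>
     is_cocone J C F L \<iota> \<and>
     (\<forall>M \<kappa>. is_cocone J C F M \<kappa> \<longrightarrow>
        (\<exists>!h. h \<in> Hom C L M \<and> (\<forall>j\<in>Ob J. Cmp C (FOb F j) L M h (\<iota> j) = \<kappa> j)))"

text \<open>
  Every category with small sets of objects and arrows is isomorphic to one whose objects and
  arrows are elements of \<open>'u\<close>, so it suffices to let the diagram shapes range over these.
\<close>

definition small_cocomplete :: "'u itself \<Rightarrow> ('o, 'm) cat \<Rightarrow> bool" where
  "small_cocomplete _ C \<longleftrightarrow>
     is_category C \<and>
     (\<forall>(J :: ('u, 'u) cat) F. small_category J \<and> is_functor J C F \<longrightarrow>
        (\<exists>L \<iota>. is_colimit J C F L \<iota>))"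


section \<open>Monads and Eilenberg--Moore categories\<close>

record ('o, 'm) monad = "('o, 'm, 'o, 'm) func" +
  Unit :: "'o \<Rightarrow> 'm"
  Mult :: "'o \<Rightarrow> 'm"

definition is_monad :: "('o, 'm) cat \<Rightarrow> ('o, 'm) monad \<Rightarrow> bool" where
  "is_monad C H \<longleftrightarrow>
     is_functor C C H \<and>
     (\<forall>X\<in>Ob C. Unit H X \<in> Hom C X (FOb H X)) \<and>
     (\<forall>X\<in>Ob C. Mult H X \<in> Hom C (FOb H (FOb H X)) (FOb H X)) \<and>
     (\<forall>X\<in>Ob C. \<forall>Y\<in>Ob C. \<forall>f\<in>Hom C X Y.
        Cmp C X (FOb H X) (FOb H Y) (FHom H X Y f) (Unit H X)
          = Cmp C X Y (FOb H Y) (Unit H Y) f) \<and>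
     (\<forall>X\<in>Ob C. \<forall>Y\<in>Ob C. \<forall>f\<in>Hom C X Y.
        Cmp C (FOb H (FOb H X)) (FOb H X) (FOb H Y) (FHom H X Y f) (Mult H X)
          = Cmp C (FOb H (FOb H X)) (FOb H (FOb H Y)) (FOb H Y)
              (Mult H Y) (FHom H (FOb H X) (FOb H Y) (FHom H X Y f))) \<and>
     (\<forall>X\<in>Ob C.
        Cmp C (FOb H X) (FOb H (FOb H X)) (FOb H X) (Mult H X) (Unit H (FOb H X))
          = Idn C (FOb H X) \<and>
        Cmp C (FOb H X) (FOb H (FOb H X)) (FOb H X) (Mult H X) (FHom H X (FOb H X) (Unit H X))
          = Idn C (FOb H X)) \<and>
     (\<forall>X\<in>Ob C.
        Cmp C (FOb H (FOb H (FOb H X))) (FOb H (FOb H X)) (FOb H X)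
            (Mult H X) (Mult H (FOb H X))
          = Cmp C (FOb H (FOb H (FOb H X))) (FOb H (FOb H X)) (FOb H X)
              (Mult H X) (FHom H (FOb H (FOb H X)) (FOb H X) (Mult H X)))"

definition is_algebra :: "('o, 'm) cat \<Rightarrow> ('o, 'm) monad \<Rightarrow> 'o \<Rightarrow> 'm \<Rightarrow> bool" where
  "is_algebra C H X a \<longleftrightarrow>
     X \<in> Ob C \<and> a \<in> Hom C (FOb H X) X \<and>
     Cmp C X (FOb H X) X a (Unit H X) = Idn C X \<and>
     Cmp C (FOb H (FOb H X)) (FOb H X) X a (Mult H X)
       = Cmp C (FOb H (FOb H X)) (FOb H X) X a (FHom H (FOb H X) X a)"

definition EM :: "('o, 'm) cat \<Rightarrow> ('o, 'm) monad \<Rightarrow> ('o \<times> 'm, 'm) cat" where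
  "EM C H = \<lparr>
     Ob = {(X, a). is_algebra C H X a},
     Hom = (\<lambda>(X, a) (Y, b).
       {f \<in> Hom C X Y.
          Cmp C (FOb H X) X Y f a = Cmp C (FOb H X) (FOb H Y) Y b (FHom H X Y f)}),
     Idn = (\<lambda>(X, a). Idn C X),
     Cmp = (\<lambda>(X, a) (Y, b) (Z, c). Cmp C X Y Z) \<rparr>"


section \<open>Concrete categories\<close>

text \<open>
  Arrows are functions that are \<open>undefined\<close> outside the underlying set of their domain, so that
  two arrows are equal iff they agree there.
\<close>

definition concrete_cat ::
    "'o set \<Rightarrow> ('o \<Rightarrow> 'u set) \<Rightarrow> ('o \<Rightarrow> 'o \<Rightarrow> ('u \<Rightarrow> 'u) \<Rightarrow> bool) \<Rightarrow> ('o, 'u \<Rightarrow> 'u) cat" where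
  "concrete_cat obs pts mor = \<lparr>
     Ob = obs,
     Hom = (\<lambda>X Y. {f \<in> extensional (pts X). mor X Y f}),
     Idn = (\<lambda>X. restrict (\<lambda>x. x) (pts X)),
     Cmp = (\<lambda>X Y Z g f. compose (pts X) g f) \<rparr>"

definition Tych :: "('u topology, 'u \<Rightarrow> 'u) cat" where
  "Tych = concrete_cat
     {X. small (topspace X) \<and> completely_regular_space X \<and> Hausdorff_space X}
     topspace continuous_map"

definition Comp :: "('u topology, 'u \<Rightarrow> 'u) cat" where
  "Comp = concrete_cat
     {X. small (topspace X) \<and> compact_space X \<and> Hausdorff_space X}
     topspace continuous_map"

record 'a unif =
  points :: "'a set"
  entourages :: "('a \<times> 'a) set set"

definition uniform_structure :: "'a unif \<Rightarrow> bool" where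
  "uniform_structure X \<longleftrightarrow>
     entourages X \<noteq> {} \<and>
     (\<forall>E\<in>entourages X. Id_on (points X) \<subseteq> E \<and> E \<subseteq> points X \<times> points X) \<and>
     (\<forall>E\<in>entourages X. \<forall>D. E \<subseteq> D \<and> D \<subseteq> points X \<times> points X \<longrightarrow> D \<in> entourages X) \<and>
     (\<forall>E\<in>entourages X. \<forall>D\<in>entourages X. E \<inter> D \<in> entourages X) \<and>
     (\<forall>E\<in>entourages X. E\<inverse> \<in> entourages X) \<and>
     (\<forall>E\<in>entourages X. \<exists>D\<in>entourages X. D O D \<subseteq> E)"

definition separated :: "'a unif \<Rightarrow> bool" where
  "separated X \<longleftrightarrow> \<Inter>(entourages X) = Id_on (points X)"

definition unif_topology :: "'a unif \<Rightarrow> 'a topology" where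
  "unif_topology X = topology (\<lambda>U. U \<subseteq> points X \<and> (\<forall>x\<in>U. \<exists>E\<in>entourages X. E `` {x} \<subseteq> U))"

definition unif_continuous :: "'a unif \<Rightarrow> 'b unif \<Rightarrow> ('a \<Rightarrow> 'b) \<Rightarrow> bool" where
  "unif_continuous X Y f \<longleftrightarrow>
     f \<in> points X \<rightarrow> points Y \<and>
     (\<forall>E\<in>entourages Y. {(x, x') \<in> points X \<times> points X. (f x, f x') \<in> E} \<in> entourages X)"

definition Unif :: "('u unif, 'u \<Rightarrow> 'u) cat" where
  "Unif = concrete_cat
     {X. small (points X) \<and> uniform_structure X \<and> separated X}
     points unif_continuous"


section \<open>The monads given by product with a group\<close>

definition topological_group :: "('a, 'b) monoid_scheme \<Rightarrow> 'a topology \<Rightarrow> bool" where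
  "topological_group G T \<longleftrightarrow>
     group G \<and> topspace T = carrier G \<and>
     continuous_map (prod_topology T T) T (\<lambda>(x, y). x \<otimes>\<^bsub>G\<^esub> y) \<and>
     continuous_map T T (\<lambda>x. inv\<^bsub>G\<^esub> x)"

text \<open>
  Since all spaces have their points in \<open>'u\<close>, ordered pairs are encoded as elements of \<open>'u\<close>. Such
  an encoding exists whenever \<open>'u\<close> is infinite.
\<close>

definition upair :: "'u \<times> 'u \<Rightarrow> 'u" where
  "upair = (SOME p. inj p)"

definition unpair :: "'u \<Rightarrow> 'u \<times> 'u" where
  "unpair = inv_into UNIV upair"

definition top_product :: "'u topology \<Rightarrow> 'u topology \<Rightarrow> 'u topology" where
  "top_product T X =
     pullback_topology (upair ` (topspace T \<times> topspace X)) unpair (prod_topology T X)"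

definition unif_product :: "'u unif \<Rightarrow> 'u unif \<Rightarrow> 'u unif" where
  "unif_product A X =
     (let P = upair ` (points A \<times> points X) in
      \<lparr> points = P,
        entourages = {E. E \<subseteq> P \<times> P \<and>
          (\<exists>U\<in>entourages A. \<exists>V\<in>entourages X. \<forall>(g, g')\<in>U. \<forall>(x, x')\<in>V.
             (upair (g, x), upair (g', x')) \<in> E)} \<rparr>)"

text \<open>The unique uniformity inducing a given compact Hausdorff topology.\<close>

definition compact_unif :: "'a topology \<Rightarrow> 'a unif" where
  "compact_unif T =
     (THE A. points A = topspace T \<and> uniform_structure A \<and> unif_topology A = T)"

text \<open>\<open>P X\<close> is the product of \<open>G\<close> with \<open>X\<close>.\<close>

definition action_monad ::
    "('u, 'b) monoid_scheme \<Rightarrow> ('o \<Rightarrow> 'u set) \<Rightarrow> ('o \<Rightarrow> 'o) \<Rightarrow> ('o, 'u \<Rightarrow> 'u) monad" where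
  "action_monad G pts P = \<lparr>
     FOb = P,
     FHom = (\<lambda>X Y f. restrict (\<lambda>p. case unpair p of (g, x) \<Rightarrow> upair (g, f x)) (pts (P X))),
     Unit = (\<lambda>X. restrict (\<lambda>x. upair (\<one>\<^bsub>G\<^esub>, x)) (pts X)),
     Mult = (\<lambda>X. restrict
       (\<lambda>p. case unpair p of (g, q) \<Rightarrow> case unpair q of (h, x) \<Rightarrow> upair (g \<otimes>\<^bsub>G\<^esub> h, x))
       (pts (P (P X)))) \<rparr>"

definition top_monad ::
    "('u, 'b) monoid_scheme \<Rightarrow> 'u topology \<Rightarrow> ('u topology, 'u \<Rightarrow> 'u) monad" where
  "top_monad G T = action_monad G topspace (top_product T)"

definition unif_monad ::
    "('u, 'b) monoid_scheme \<Rightarrow> 'u topology \<Rightarrow> ('u unif, 'u \<Rightarrow> 'u) monad" where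
  "unif_monad G T = action_monad G points (unif_product (compact_unif T))"

end

theory Submission
  imports Defs
begin

text \<open>
  The colimit of a diagram of algebras is built from all its cocones at once. The disjoint union
  \<open>A\<close> of the underlying sets of the diagram maps into the product of the vertices of all cocones;
  the image of \<open>A\<close> (its closure, for compact spaces) is invariant under \<open>G\<close>, and with the structure
  induced by the projections it is the vertex of a colimit. The family of all cocones is not small,
  but the image is a quotient of \<open>A\<close>, and its closure embeds into \<open>Pow (Pow A)\<close>, so both are
  small because the universe is a strong limit.
\<close>

text \<open>The delicate point is continuity of the action in both variables together. On a colimit
  formed in the base category it would depend on how product with \<open>G\<close> treats quotients.
  Here only points are constructed by hand: each single \<open>g\<close> acts on every vertex
  \<open>M i\<close> by an endomorphism, and this fixes where a point of the new vertex must go.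
  Joint continuity then follows from initiality, since \<open>p i\<close> after the new action
  equals the action \<open>b i\<close> after \<open>p i\<close> on the second coordinate, a
  composite of known morphisms. Using all cocones makes the universal property almost tautological:
  a given cocone is one of the indices, the mediating map is its projection, and uniqueness is the
  epimorphism property of \<open>e\<close>. \<open>A\<close> is a bare set without topology;
  continuity of the legs is also tested on projections. Compact spaces call for the closure because
  the image of \<open>A\<close> need not be compact. Points of the product are functions on the
  large index set and do not lie in \<open>'u\<close>, so in the topological cases the vertex is
  moved to a copy inside \<open>'u\<close>.\<close>

lemma upair_inj:
  assumes "infinite (UNIV :: 'u set)"
  shows "inj (upair :: 'u \<times> 'u \<Rightarrow> 'u)"
proof -
  have "\<exists>p :: 'u \<times> 'u \<Rightarrow> 'u. inj p"
    using card_of_Times_same_infinite[OF assms] card_of_ordIso bij_betw_imp_inj_on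
    by (metis UNIV_Times_UNIV)
  then show ?thesis
    unfolding upair_def by (rule someI_ex)
qed

section \<open>Small sets\<close>

lemma small_lepoll: "S \<lesssim> A \<Longrightarrow> small A \<Longrightarrow> small S" for S A :: "'u set"
  unfolding small_def by (rule lesspoll_trans1)

lemma small_image: "small A \<Longrightarrow> small (f ` A)" for A :: "'u set" and f :: "'u \<Rightarrow> 'u"
  using image_lepoll small_lepoll by blast

text \<open>Regularity of the universe enters here. It bounds the disjoint union of a small diagram
  and, for a constant family, the point set of a product with \<open>G\<close>.\<close>

lemma small_upair_Sigma:
  assumes "universe TYPE('u)" "small (I :: 'u set)" "\<And>i. i \<in> I \<Longrightarrow> small (A i :: 'u set)"
  shows "small (upair ` Sigma I A)"
proof -
  have "small (\<Union>i\<in>I. (\<lambda>x. upair (i, x)) ` A i)"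
    using assms unfolding universe_def by (metis (no_types, lifting) small_image)
  moreover have "upair ` Sigma I A = (\<Union>i\<in>I. (\<lambda>x. upair (i, x)) ` A i)"
    by auto
  ultimately show ?thesis
    by simp
qed

text \<open>\<open>S\<close> may lie in any type; applying the strong limit property twice leaves
  room for a copy of it in \<open>'u\<close>. Two power sets are what a closure costs, by
  \<open>closure_of_lepoll\<close>.\<close>

lemma small_copy:
  assumes "universe TYPE('u)" "small (A :: 'u set)" "S \<lesssim> Pow (Pow A)"
  shows "\<exists>c :: _ \<Rightarrow> 'u. inj_on c S \<and> small (c ` S)"
proof -
  have small_Pow: "Pow B \<prec> (UNIV :: 'u set)" if "small B" for B :: "'u set"
    using assms(1) that unfolding universe_def by blast
  \<comment> \<open>The strong limit property speaks only of subsets of \<open>'u\<close>, so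
    \<open>Pow A\<close> is coded into \<open>'u\<close> by \<open>k\<close> before the second power
    set is formed.\<close>
  obtain k :: "'u set \<Rightarrow> 'u" where k: "inj_on k (Pow A)"
    using small_Pow[OF assms(2)] lesspoll_imp_lepoll unfolding lepoll_def by blast
  have "small (k ` Pow A)"
    using small_Pow[OF assms(2)] image_lepoll lesspoll_trans1 unfolding small_def by blast
  then have "Pow (k ` Pow A) \<prec> (UNIV :: 'u set)"
    by (rule small_Pow)
  have "Pow (Pow A) \<lesssim> Pow (k ` Pow A)"
    unfolding lepoll_def using k by (intro exI[of _ "(`) k"]) (auto intro: inj_on_image_Pow)
  with assms(3) have "S \<lesssim> Pow (k ` Pow A)"
    by (rule lepoll_trans)
  then have S: "S \<prec> (UNIV :: 'u set)"
    using \<open>Pow (k ` Pow A) \<prec> UNIV\<close> by (rule lesspoll_trans1)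
  then obtain c :: "_ \<Rightarrow> 'u" where "inj_on c S"
    using lesspoll_imp_lepoll unfolding lepoll_def by blast
  moreover have "small (c ` S)"
    unfolding small_def using image_lepoll S by (rule lesspoll_trans1)
  ultimately show ?thesis
    by blast
qed

section \<open>Colimits of algebras from factorizations\<close>

text \<open>
  \<open>L\<close> is the middle object of a factorization of the family of maps \<open>f i : A \<rightarrow> M i\<close> as an
  epimorphism \<open>e\<close> followed by an initial monomorphic family \<open>p i\<close>. By \<open>endo_lift\<close>, endomorphisms of
  the \<open>M i\<close> that preserve the image of \<open>A\<close> also preserve \<open>L\<close>; this is how \<open>L\<close> gets its action.
\<close>

locale factorization =
  fixes obs :: "'o set" and pts :: "'o \<Rightarrow> 'u set"
    and mor :: "'o \<Rightarrow> 'o \<Rightarrow> ('u \<Rightarrow> 'u) \<Rightarrow> bool"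
    and A :: "'u set" and I :: "'i set" and M :: "'i \<Rightarrow> 'o" and f :: "'i \<Rightarrow> 'u \<Rightarrow> 'u"
    and L :: 'o and e :: "'u \<Rightarrow> 'u" and p :: "'i \<Rightarrow> 'u \<Rightarrow> 'u"
  assumes L_obs: "L \<in> obs"
    and e_pts: "x \<in> A \<Longrightarrow> e x \<in> pts L"
    and p_mor: "i \<in> I \<Longrightarrow> mor L (M i) (p i)"
    and p_e: "i \<in> I \<Longrightarrow> x \<in> A \<Longrightarrow> p i (e x) = f i x"
    and p_separate: "x \<in> pts L \<Longrightarrow> y \<in> pts L \<Longrightarrow> (\<And>i. i \<in> I \<Longrightarrow> p i x = p i y) \<Longrightarrow> x = y"
    and p_initial: "Y \<in> obs \<Longrightarrow> h \<in> pts Y \<rightarrow> pts L \<Longrightarrow>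
      (\<And>i. i \<in> I \<Longrightarrow> mor Y (M i) (\<lambda>y. p i (h y))) \<Longrightarrow> mor Y L h"
    and e_epi: "Y \<in> obs \<Longrightarrow> mor L Y h \<Longrightarrow> mor L Y k \<Longrightarrow>
      (\<And>x. x \<in> A \<Longrightarrow> h (e x) = k (e x)) \<Longrightarrow> x \<in> pts L \<Longrightarrow> h x = k x"
    and endo_lift: "(\<And>i. i \<in> I \<Longrightarrow> mor (M i) (M i) (u i)) \<Longrightarrow>
      (\<And>x. x \<in> A \<Longrightarrow> \<exists>y\<in>A. \<forall>i\<in>I. u i (f i x) = f i y) \<Longrightarrow> x \<in> pts L \<Longrightarrow>
      \<exists>y\<in>pts L. \<forall>i\<in>I. p i y = u i (p i x)"

text \<open>This interface is what the three categories share, so that the colimit argument is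
  carried out once. \<open>mor_slice\<close> and \<open>mor_P\<close> say how products with
  \<open>G\<close> interact with morphisms. The index type in \<open>factorization_exists\<close> is
  fixed to triples because a locale assumption cannot be polymorphic in it; triples are enough to
  code cocones.\<close>

locale action_category =
  group G for G :: "('u, 'b) monoid_scheme" (structure) +
  fixes obs :: "'o set" and pts :: "'o \<Rightarrow> 'u set"
    and mor :: "'o \<Rightarrow> 'o \<Rightarrow> ('u \<Rightarrow> 'u) \<Rightarrow> bool"
    and P :: "'o \<Rightarrow> 'o"
  assumes universe: "universe TYPE('u)"
    and small_pts: "X \<in> obs \<Longrightarrow> small (pts X)"
    and mor_pts: "mor X Y f \<Longrightarrow> x \<in> pts X \<Longrightarrow> f x \<in> pts Y"
    and mor_cong: "mor X Y f \<Longrightarrow> (\<And>x. x \<in> pts X \<Longrightarrow> f x = g x) \<Longrightarrow> mor X Y g"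
    and mor_id: "X \<in> obs \<Longrightarrow> mor X X (\<lambda>x. x)"
    and mor_comp: "mor X Y f \<Longrightarrow> mor Y Z g \<Longrightarrow> mor X Z (\<lambda>x. g (f x))"
    and P_obs: "X \<in> obs \<Longrightarrow> P X \<in> obs"
    and pts_P: "X \<in> obs \<Longrightarrow> pts (P X) = upair ` (carrier G \<times> pts X)"
    and mor_slice: "X \<in> obs \<Longrightarrow> k \<in> carrier G \<Longrightarrow> mor X (P X) (\<lambda>x. upair (k, x))"
    and mor_P: "X \<in> obs \<Longrightarrow> Y \<in> obs \<Longrightarrow> mor X Y f \<Longrightarrow>
      mor (P X) (P Y) (\<lambda>q. case unpair q of (g, x) \<Rightarrow> upair (g, f x))"
    and factorization_exists: "\<And>A (I :: ('o \<times> ('u \<Rightarrow> 'u) \<times> ('u \<Rightarrow> 'u)) set) M f.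
      small A \<Longrightarrow> (\<And>i. i \<in> I \<Longrightarrow> M i \<in> obs) \<Longrightarrow> (\<And>i. i \<in> I \<Longrightarrow> f i \<in> A \<rightarrow> pts (M i)) \<Longrightarrow>
      \<exists>L e p. factorization obs pts mor A I M f L e p"
begin

abbreviation \<E> where "\<E> \<equiv> EM (concrete_cat obs pts mor) (action_monad G pts P)"

lemma inj_upair: "inj (upair :: 'u \<times> 'u \<Rightarrow> 'u)"
  using universe upair_inj unfolding universe_def by blast

lemma upair_eq [simp]: "upair (x, y) = upair (x', y' :: 'u) \<longleftrightarrow> x = x' \<and> y = y'"
  using inj_upair by (auto dest: injD)

lemma unpair_upair [simp]: "unpair (upair q) = (q :: 'u \<times> 'u)"
  unfolding unpair_def using inj_upair by simp

lemma mem_P [simp]: "X \<in> obs \<Longrightarrow> upair (g, x) \<in> pts (P X) \<longleftrightarrow> g \<in> carrier G \<and> x \<in> pts X"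
  by (auto simp: pts_P)

lemma ball_P: "X \<in> obs \<Longrightarrow> (\<forall>q\<in>pts (P X). R q) \<longleftrightarrow> (\<forall>g\<in>carrier G. \<forall>x\<in>pts X. R (upair (g, x)))"
  by (auto simp: pts_P)

text \<open>Arrows are extensional, so the two equations of an algebra can be tested on points.
  Points of \<open>P X\<close> and \<open>P (P X)\<close> are coded pairs and nested pairs, which
  turns the equations into the laws of a group action.\<close>

lemma Ob_EM:
  "(X, a) \<in> Ob \<E> \<longleftrightarrow>
     X \<in> obs \<and> a \<in> extensional (pts (P X)) \<and> mor (P X) X a \<and>
     (\<forall>x\<in>pts X. a (upair (\<one>, x)) = x) \<and>
     (\<forall>g\<in>carrier G. \<forall>h\<in>carrier G. \<forall>x\<in>pts X.
        a (upair (g \<otimes> h, x)) = a (upair (g, a (upair (h, x)))))"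
proof (cases "X \<in> obs \<and> a \<in> extensional (pts (P X)) \<and> mor (P X) X a")
  case True
  then have [simp]: "X \<in> obs" "P X \<in> obs"
    by (simp_all add: P_obs)
  have "compose (pts X) a (restrict (\<lambda>x. upair (\<one>, x)) (pts X)) = restrict (\<lambda>x. x) (pts X) \<longleftrightarrow>
      (\<forall>x\<in>pts X. a (upair (\<one>, x)) = x)"
    by (auto simp: compose_def fun_eq_iff restrict_def split: if_splits)
  moreover have "compose (pts (P (P X))) a (Mult (action_monad G pts P) X)
        = compose (pts (P (P X))) a (FHom (action_monad G pts P) (P X) X a) \<longleftrightarrow>
      (\<forall>q\<in>pts (P (P X)). a (Mult (action_monad G pts P) X q)
        = a (FHom (action_monad G pts P) (P X) X a q))"
    by (auto simp: compose_def fun_eq_iff restrict_def split: if_splits)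
  moreover have "(\<forall>q\<in>pts (P (P X)). a (Mult (action_monad G pts P) X q)
        = a (FHom (action_monad G pts P) (P X) X a q)) \<longleftrightarrow>
      (\<forall>g\<in>carrier G. \<forall>h\<in>carrier G. \<forall>x\<in>pts X.
        a (upair (g \<otimes> h, x)) = a (upair (g, a (upair (h, x)))))"
    by (simp add: ball_P action_monad_def)
  ultimately show ?thesis
    using True unfolding EM_def is_algebra_def concrete_cat_def
    by (simp add: action_monad_def)
next
  case False
  then show ?thesis
    by (auto simp: EM_def is_algebra_def concrete_cat_def action_monad_def)
qed

lemma Hom_EM:
  assumes "(X, a) \<in> Ob \<E>"
  shows "f \<in> Hom \<E> (X, a) (Y, b) \<longleftrightarrow>
     f \<in> extensional (pts X) \<and> mor X Y f \<and>
     (\<forall>g\<in>carrier G. \<forall>x\<in>pts X. f (a (upair (g, x))) = b (upair (g, f x)))"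
proof -
  have [simp]: "X \<in> obs"
    using assms by (simp add: Ob_EM)
  have "compose (pts (P X)) f a = compose (pts (P X)) b (FHom (action_monad G pts P) X Y f) \<longleftrightarrow>
      (\<forall>q\<in>pts (P X). f (a q) = b (FHom (action_monad G pts P) X Y f q))"
    by (auto simp: compose_def fun_eq_iff restrict_def split: if_splits)
  moreover have "\<dots> \<longleftrightarrow> (\<forall>g\<in>carrier G. \<forall>x\<in>pts X. f (a (upair (g, x))) = b (upair (g, f x)))"
    by (simp add: ball_P action_monad_def)
  ultimately show ?thesis
    unfolding EM_def concrete_cat_def by (simp add: action_monad_def)
qed

lemma Cmp_EM: "Cmp \<E> (X, a) (Y, b) (Z, c) g f = compose (pts X) g f"
  by (simp add: EM_def concrete_cat_def)

lemma Idn_EM: "Idn \<E> (X, a) = restrict (\<lambda>x. x) (pts X)"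
  by (simp add: EM_def concrete_cat_def)

lemma action_closed:
  assumes "(X, a) \<in> Ob \<E>" "g \<in> carrier G" "x \<in> pts X"
  shows "a (upair (g, x)) \<in> pts X"
  using assms mor_pts[of "P X" X a] by (simp add: Ob_EM)

text \<open>A slice followed by the action. These translations are the endomorphisms handed to
  \<open>endo_lift\<close> when the vertex of the colimit receives its action.\<close>

lemma mor_translation:
  assumes "(X, a) \<in> Ob \<E>" "g \<in> carrier G"
  shows "mor X X (\<lambda>x. a (upair (g, x)))"
  using assms mor_comp[OF mor_slice] by (simp add: Ob_EM)

lemma category_EM: "is_category \<E>"
proof -
  have "Idn \<E> (X, a) \<in> Hom \<E> (X, a) (X, a)" if "(X, a) \<in> Ob \<E>" for X a
    using that action_closed[OF that] mor_cong[OF mor_id]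
    by (simp add: Hom_EM[OF that] Idn_EM) (simp add: Ob_EM)
  moreover have "compose (pts X) g f \<in> Hom \<E> (X, a) (Z, c)"
    if "(X, a) \<in> Ob \<E>" "(Y, b) \<in> Ob \<E>" "f \<in> Hom \<E> (X, a) (Y, b)" "g \<in> Hom \<E> (Y, b) (Z, c)"
    for X a Y b Z c f g
  proof -
    have f: "mor X Y f" "\<forall>g\<in>carrier G. \<forall>x\<in>pts X. f (a (upair (g, x))) = b (upair (g, f x))"
      and g: "mor Y Z g" "\<forall>h\<in>carrier G. \<forall>y\<in>pts Y. g (b (upair (h, y))) = c (upair (h, g y))"
      using that by (simp_all add: Hom_EM)
    have "mor X Z (compose (pts X) g f)"
      by (rule mor_cong[OF mor_comp[OF f(1) g(1)]]) (simp add: compose_eq)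
    then show ?thesis
      using f g mor_pts[OF f(1)] action_closed[OF that(1)]
      by (simp add: Hom_EM[OF that(1)] compose_eq)
  qed
  moreover have "compose (pts X) f (restrict (\<lambda>x. x) (pts X)) = f"
      "compose (pts X) (restrict (\<lambda>x. x) (pts Y)) f = f"
    if "(X, a) \<in> Ob \<E>" "f \<in> Hom \<E> (X, a) (Y, b)" for X a Y b f
    using that mor_pts[of X Y f]
    by (auto simp: Hom_EM compose_def fun_eq_iff extensional_def)
  moreover have "compose (pts W) (compose (pts X) h g) f = compose (pts W) h (compose (pts W) g f)"
    if "(W, d) \<in> Ob \<E>" "f \<in> Hom \<E> (W, d) (X, a)" for W d X a f g h
    using that mor_pts[of W X f] by (auto simp: Hom_EM compose_def fun_eq_iff)
  ultimately show ?thesis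
    unfolding is_category_def by (auto simp: Cmp_EM Idn_EM)
qed

lemma cocone_EM:
  assumes "is_functor J \<E> F"
  shows "is_cocone J \<E> F (M, b) \<kappa> \<longleftrightarrow>
     (M, b) \<in> Ob \<E> \<and>
     (\<forall>j\<in>Ob J. \<kappa> j \<in> Hom \<E> (FOb F j) (M, b)) \<and>
     (\<forall>i\<in>Ob J. \<forall>j\<in>Ob J. \<forall>s\<in>Hom J i j. \<forall>x\<in>pts (fst (FOb F i)). \<kappa> j (FHom F i j s x) = \<kappa> i x)"
proof (cases "\<forall>j\<in>Ob J. \<kappa> j \<in> Hom \<E> (FOb F j) (M, b)")
  case True
  have "compose (pts (fst (FOb F i))) g f = \<kappa> i \<longleftrightarrow> (\<forall>x\<in>pts (fst (FOb F i)). g (f x) = \<kappa> i x)"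
    if "i \<in> Ob J" for i and f g :: "'u \<Rightarrow> 'u"
  proof -
    have "\<kappa> i \<in> extensional (pts (fst (FOb F i)))"
      using True assms that Hom_EM[of "fst (FOb F i)" "snd (FOb F i)"]
      unfolding is_functor_def by (metis prod.collapse)
    then show ?thesis
      by (auto simp: compose_def fun_eq_iff extensional_def restrict_def)
  qed
  moreover have "Cmp \<E> (FOb F i) (FOb F j) (M, b) g f = compose (pts (fst (FOb F i))) g f"
    for i j and f g :: "'u \<Rightarrow> 'u"
    by (metis Cmp_EM prod.collapse)
  ultimately show ?thesis
    using True by (simp add: is_cocone_def cong: ball_cong)
qed (auto simp: is_cocone_def)

lemma colimit_exists:
  assumes J: "small_category (J :: ('u, 'u) cat)" and F: "is_functor J \<E> F"
  shows "\<exists>L \<iota>. is_colimit J \<E> F L \<iota>"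
proof -
  define X a where "X j = fst (FOb F j)" and "a j = snd (FOb F j)" for j
  have FX: "FOb F j = (X j, a j)" for j
    by (simp add: X_def a_def)
  have Xa: "(X j, a j) \<in> Ob \<E>" if "j \<in> Ob J" for j
    using F that unfolding is_functor_def FX by blast
  then have X: "X j \<in> obs" if "j \<in> Ob J" for j
    using that by (simp add: Ob_EM)
  have Fhom: "FHom F i j s \<in> Hom \<E> (X i, a i) (X j, a j)"
    if "i \<in> Ob J" "j \<in> Ob J" "s \<in> Hom J i j" for i j s
    using F that unfolding is_functor_def FX by blast
  define A where "A = upair ` (SIGMA j:Ob J. pts (X j))"
  have "small A"
    unfolding A_def using J X small_pts
    by (intro small_upair_Sigma[OF universe]) (auto simp: small_category_def)
  \<comment> \<open>A map on \<open>A\<close> is cut into its parts on the summands;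
    \<open>restrict\<close> makes them extensional, as arrows must be.\<close>
  define leg where "leg f j = restrict (\<lambda>x. f (upair (j, x)) :: 'u) (pts (X j))" for f j
  txt \<open>A cocone is coded as a triple of its vertex, the action there, and the map it induces on \<open>A\<close>.\<close>
  define I where "I = {(M, b, f). is_cocone J \<E> F (M, b) (leg f)}"
  define M b f where "M i = fst i" and "b i = fst (snd i)" and "f i = snd (snd i)"
    for i :: "'o \<times> ('u \<Rightarrow> 'u) \<times> ('u \<Rightarrow> 'u)"
  have cocone: "is_cocone J \<E> F (M i, b i) (leg (f i))" if "i \<in> I" for i
    using that by (auto simp: I_def M_def b_def f_def)
  have Mb: "(M i, b i) \<in> Ob \<E>" if "i \<in> I" for i
    using cocone[OF that] by (simp add: is_cocone_def)
  then have M: "M i \<in> obs" if "i \<in> I" for i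
    using that by (simp add: Ob_EM)
  have leg: "mor (X j) (M i) (\<lambda>x. f i (upair (j, x)))"
    "\<And>g x. g \<in> carrier G \<Longrightarrow> x \<in> pts (X j) \<Longrightarrow>
       f i (upair (j, a j (upair (g, x)))) = b i (upair (g, f i (upair (j, x))))"
    if "i \<in> I" "j \<in> Ob J" for i j
  proof -
    have *: "leg (f i) j \<in> Hom \<E> (X j, a j) (M i, b i)"
      using cocone[OF that(1)] that(2) unfolding is_cocone_def FX by blast
    then have "mor (X j) (M i) (leg (f i) j)"
      using Hom_EM[OF Xa[OF that(2)]] by blast
    then show "mor (X j) (M i) (\<lambda>x. f i (upair (j, x)))"
      by (rule mor_cong) (simp add: leg_def)
    show "f i (upair (j, a j (upair (g, x)))) = b i (upair (g, f i (upair (j, x))))"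
      if "g \<in> carrier G" "x \<in> pts (X j)" for g x
    proof -
      have "leg (f i) j (a j (upair (g, x))) = b i (upair (g, leg (f i) j x))"
        using * that Hom_EM[OF Xa[OF \<open>j \<in> Ob J\<close>]] by blast
      then show ?thesis
        using that action_closed[OF Xa[OF \<open>j \<in> Ob J\<close>] that] by (simp add: leg_def)
    qed
  qed
  have f: "f i \<in> A \<rightarrow> pts (M i)" if "i \<in> I" for i
    using leg(1)[OF that, THEN mor_pts] by (auto simp: A_def)
  obtain L e p where "factorization obs pts mor A I M f L e p"
    using factorization_exists[of A I M f] \<open>small A\<close> M f by blast
  then interpret factorization obs pts mor A I M f L e p .
  \<comment> \<open>Translation by \<open>g\<close> respects the image of \<open>A\<close>: the legs
    are equivariant, so the image of \<open>(j, x)\<close> goes to that of \<open>(j, g x)\<close>.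
    This is the same point of \<open>A\<close> for every index \<open>i\<close>, as
    \<open>endo_lift\<close> demands.\<close>
  have "\<exists>y\<in>pts L. \<forall>i\<in>I. p i y = b i (upair (g, p i x))" if "g \<in> carrier G" "x \<in> pts L" for g x
  proof (rule endo_lift[OF _ _ that(2)])
    show "mor (M i) (M i) (\<lambda>z. b i (upair (g, z)))" if "i \<in> I" for i
      using mor_translation[OF Mb[OF that]] \<open>g \<in> carrier G\<close> by blast
    fix z assume "z \<in> A"
    then obtain j x where z: "z = upair (j, x)" "j \<in> Ob J" "x \<in> pts (X j)"
      by (auto simp: A_def)
    then have "upair (j, a j (upair (g, x))) \<in> A"
      using action_closed[OF Xa] \<open>g \<in> carrier G\<close> by (auto simp: A_def)
    then show "\<exists>y\<in>A. \<forall>i\<in>I. b i (upair (g, f i z)) = f i y"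
      using leg(2) z \<open>g \<in> carrier G\<close> by (intro bexI) auto
  qed
  then obtain \<rho> where \<rho>: "\<And>g x. g \<in> carrier G \<Longrightarrow> x \<in> pts L \<Longrightarrow> \<rho> g x \<in> pts L"
    and p\<rho>: "\<And>g x i. g \<in> carrier G \<Longrightarrow> x \<in> pts L \<Longrightarrow> i \<in> I \<Longrightarrow> p i (\<rho> g x) = b i (upair (g, p i x))"
    by metis
  define \<alpha> where "\<alpha> = restrict (\<lambda>q. case unpair q of (g, x) \<Rightarrow> \<rho> g x) (pts (P L))"
  have \<alpha>: "\<alpha> (upair (g, x)) = \<rho> g x" if "g \<in> carrier G" "x \<in> pts L" for g x
    using that L_obs by (simp add: \<alpha>_def)
  \<comment> \<open>Tested on the projection \<open>p i\<close>, the map \<open>\<alpha>\<close>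
    becomes \<open>b i\<close> after the morphism that \<open>mor_P\<close> builds from
    \<open>p i\<close>.\<close>
  have "mor (P L) L \<alpha>"
  proof (rule p_initial[OF P_obs[OF L_obs]])
    show "\<alpha> \<in> pts (P L) \<rightarrow> pts L"
      using \<rho> by (auto simp: pts_P[OF L_obs] \<alpha>)
    fix i assume i: "i \<in> I"
    have "mor (P L) (M i) (\<lambda>q. b i (case unpair q of (g, x) \<Rightarrow> upair (g, p i x)))"
      using Mb[OF i] by (intro mor_comp[OF mor_P[OF L_obs M[OF i] p_mor[OF i]]]) (simp add: Ob_EM)
    then show "mor (P L) (M i) (\<lambda>q. p i (\<alpha> q))"
      by (rule mor_cong) (auto simp: pts_P[OF L_obs] \<alpha> p\<rho>[OF _ _ i])
  qed
  \<comment> \<open>Both action laws hold in every \<open>M i\<close>, and the projections separate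
    points.\<close>
  moreover have "\<rho> \<one> x = x" if "x \<in> pts L" for x
  proof (rule p_separate)
    show "p i (\<rho> \<one> x) = p i x" if "i \<in> I" for i
      using p\<rho>[OF one_closed \<open>x \<in> pts L\<close> that] Mb[OF that] mor_pts[OF p_mor[OF that] \<open>x \<in> pts L\<close>]
      by (simp add: Ob_EM)
  qed (use that \<rho> in auto)
  moreover have "\<rho> (g \<otimes> h) x = \<rho> g (\<rho> h x)"
    if "g \<in> carrier G" "h \<in> carrier G" "x \<in> pts L" for g h x
  proof (rule p_separate)
    show "p i (\<rho> (g \<otimes> h) x) = p i (\<rho> g (\<rho> h x))" if "i \<in> I" for i
      using \<open>g \<in> carrier G\<close> \<open>h \<in> carrier G\<close> \<open>x \<in> pts L\<close> Mb[OF that]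
        mor_pts[OF p_mor[OF that] \<open>x \<in> pts L\<close>]
      by (simp add: Ob_EM p\<rho>[OF _ _ that] \<rho>)
  qed (use that \<rho> in auto)
  ultimately have L\<alpha>: "(L, \<alpha>) \<in> Ob \<E>"
    using L_obs \<alpha> \<rho> by (simp add: Ob_EM) (simp add: \<alpha>_def)
  define \<iota> where "\<iota> j = restrict (\<lambda>x. e (upair (j, x))) (pts (X j))" for j
  have A: "upair (j, x) \<in> A" if "j \<in> Ob J" "x \<in> pts (X j)" for j x
    using that by (auto simp: A_def)
  have p\<iota>: "p i (\<iota> j x) = f i (upair (j, x))" if "i \<in> I" "j \<in> Ob J" "x \<in> pts (X j)" for i j x
    using that A p_e by (simp add: \<iota>_def)
  have \<iota>_pts: "\<iota> j x \<in> pts L" if "j \<in> Ob J" "x \<in> pts (X j)" for j x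
    using that A e_pts by (simp add: \<iota>_def)
  have "mor (X j) L (\<iota> j)" if "j \<in> Ob J" for j
  proof (rule p_initial[OF X[OF that]])
    show "mor (X j) (M i) (\<lambda>x. p i (\<iota> j x))" if "i \<in> I" for i
      using leg(1)[OF that \<open>j \<in> Ob J\<close>] by (rule mor_cong) (simp add: p\<iota> that \<open>j \<in> Ob J\<close>)
  qed (use \<iota>_pts that in auto)
  moreover have "\<iota> j (a j (upair (g, x))) = \<rho> g (\<iota> j x)"
    if "j \<in> Ob J" "g \<in> carrier G" "x \<in> pts (X j)" for j g x
  proof (rule p_separate)
    show "p i (\<iota> j (a j (upair (g, x)))) = p i (\<rho> g (\<iota> j x))" if "i \<in> I" for i
      using \<open>j \<in> Ob J\<close> \<open>g \<in> carrier G\<close> \<open>x \<in> pts (X j)\<close> that action_closed[OF Xa]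
      by (simp add: p\<iota> p\<rho> leg(2) \<iota>_pts)
  qed (use that \<rho> \<iota>_pts action_closed[OF Xa] in auto)
  ultimately have \<iota>_Hom: "\<iota> j \<in> Hom \<E> (X j, a j) (L, \<alpha>)" if "j \<in> Ob J" for j
    using that by (simp add: Hom_EM[OF Xa[OF that]] \<alpha> \<iota>_pts) (simp add: \<iota>_def)
  \<comment> \<open>Every cocone in \<open>I\<close> takes the same value at the two points of
    \<open>A\<close>, so no projection distinguishes their images.\<close>
  have "\<iota> j (FHom F i j s x) = \<iota> i x"
    if "i \<in> Ob J" "j \<in> Ob J" "s \<in> Hom J i j" "x \<in> pts (X i)" for i j s x
  proof -
    have y: "FHom F i j s x \<in> pts (X j)"
      using Fhom[OF that(1-3)] that(4) mor_pts unfolding Hom_EM[OF Xa[OF that(1)]] by blast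
    have "f k (upair (j, FHom F i j s x)) = f k (upair (i, x))" if "k \<in> I" for k
    proof -
      have "leg (f k) j (FHom F i j s x) = leg (f k) i x"
        using cocone[OF that] \<open>i \<in> Ob J\<close> \<open>j \<in> Ob J\<close> \<open>s \<in> Hom J i j\<close> \<open>x \<in> pts (X i)\<close>
        unfolding cocone_EM[OF F] X_def by blast
      then show ?thesis
        using y \<open>x \<in> pts (X i)\<close> by (simp add: leg_def)
    qed
    then show ?thesis
      using that y by (intro p_separate[OF \<iota>_pts[OF that(2) y] \<iota>_pts[OF that(1,4)]]) (simp add: p\<iota>)
  qed
  then have "is_cocone J \<E> F (L, \<alpha>) \<iota>"
    unfolding cocone_EM[OF F] FX using L\<alpha> \<iota>_Hom by simp
  moreover have "\<exists>!h. h \<in> Hom \<E> (L, \<alpha>) N \<and> (\<forall>j\<in>Ob J. Cmp \<E> (FOb F j) (L, \<alpha>) N h (\<iota> j) = \<kappa> j)"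
    if "is_cocone J \<E> F N \<kappa>" for N \<kappa>
  proof -
    \<comment> \<open>The given cocone becomes an index: its legs are glued to one function on
      codes. Values outside \<open>A\<close> do not matter, because \<open>leg\<close>
      restricts.\<close>
    define i where "i = (fst N, snd N, \<lambda>q. case unpair q of (j, x) \<Rightarrow> \<kappa> j x)"
    have N: "N = (M i, b i)"
      by (simp add: i_def M_def b_def)
    have \<kappa>: "\<kappa> j \<in> Hom \<E> (X j, a j) (M i, b i)" if "j \<in> Ob J" for j
      using \<open>is_cocone J \<E> F N \<kappa>\<close> that unfolding is_cocone_def FX N by blast
    then have \<kappa>_ext: "\<kappa> j \<in> extensional (pts (X j))" if "j \<in> Ob J" for j
      using that Hom_EM[OF Xa[OF that]] by blast
    have leg_i: "leg (f i) j = \<kappa> j" if "j \<in> Ob J" for j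
      using \<kappa>_ext[OF that] unfolding leg_def i_def f_def
      by (auto simp: fun_eq_iff extensional_def restrict_def)
    have "is_cocone J \<E> F (M i, b i) (leg (f i))"
      using \<open>is_cocone J \<E> F N \<kappa>\<close> leg_i unfolding is_cocone_def N by simp
    then have i: "i \<in> I"
      unfolding I_def by (simp add: M_def b_def f_def split_beta)
    have cmp: "compose (pts (X j)) h (\<iota> j) = \<kappa> j \<longleftrightarrow> (\<forall>x\<in>pts (X j). h (\<iota> j x) = f i (upair (j, x)))"
      if "j \<in> Ob J" for j h
      using leg_i[OF that, symmetric] by (auto simp: fun_eq_iff compose_def leg_def restrict_def)
    show ?thesis
    proof (rule ex1I)
      have "mor L (M i) (restrict (p i) (pts L))"
        using p_mor[OF i] by (rule mor_cong) simp
      then show "restrict (p i) (pts L) \<in> Hom \<E> (L, \<alpha>) N \<and>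
          (\<forall>j\<in>Ob J. Cmp \<E> (FOb F j) (L, \<alpha>) N (restrict (p i) (pts L)) (\<iota> j) = \<kappa> j)"
        using i by (simp add: N FX Hom_EM[OF L\<alpha>] Cmp_EM cmp \<alpha> \<rho> p\<rho> \<iota>_pts p\<iota>)
      fix h assume h: "h \<in> Hom \<E> (L, \<alpha>) N \<and>
          (\<forall>j\<in>Ob J. Cmp \<E> (FOb F j) (L, \<alpha>) N h (\<iota> j) = \<kappa> j)"
      then have "mor L (M i) h" "h \<in> extensional (pts L)"
        by (simp_all add: N Hom_EM[OF L\<alpha>])
      moreover have "h (e q) = p i (e q)" if "q \<in> A" for q
      proof -
        obtain j x where q: "q = upair (j, x)" "j \<in> Ob J" "x \<in> pts (X j)"
          using \<open>q \<in> A\<close> unfolding A_def by blast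
        have "compose (pts (X j)) h (\<iota> j) = \<kappa> j"
          using h q(2) unfolding N FX Cmp_EM by blast
        then have "h (\<iota> j x) = f i (upair (j, x))"
          using cmp q by blast
        with q show ?thesis
          using p\<iota>[OF i q(2,3)] by (simp add: \<iota>_def)
      qed
      ultimately have "h x = p i x" if "x \<in> pts L" for x
        using e_epi[OF M[OF i] _ p_mor[OF i] _ that] by blast
      with \<open>h \<in> extensional (pts L)\<close> show "h = restrict (p i) (pts L)"
        by (intro extensionalityI[of _ "pts L"]) auto
    qed
  qed
  ultimately have "is_colimit J \<E> F (L, \<alpha>) \<iota>"
    unfolding is_colimit_def by blast
  then show ?thesis
    by blast
qed

lemma small_cocomplete_EM: "small_cocomplete TYPE('u) \<E>"
  unfolding small_cocomplete_def by (intro conjI allI impI category_EM colimit_exists) auto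

end

section \<open>Tychonoff and compact spaces\<close>

text \<open>The pullback along a left inverse \<open>d\<close> of the coding \<open>c\<close> is the
  topology of \<open>X\<close> carried over to the coded points. It serves both for the coded pairs
  of \<open>top_product\<close> and for the coded subspace of the product of all vertices.\<close>

lemma pullback_homeomorphic:
  assumes "\<And>x. x \<in> topspace X \<Longrightarrow> d (c x) = x"
  shows "homeomorphic_maps (pullback_topology (c ` topspace X) d X) X d c"
    and "topspace (pullback_topology (c ` topspace X) d X) = c ` topspace X"
proof -
  let ?Y = "pullback_topology (c ` topspace X) d X"
  show Y: "topspace ?Y = c ` topspace X"
    using assms by (auto simp: topspace_pullback_topology)
  have "continuous_map ?Y X d"
    using continuous_map_pullback[OF continuous_map_id, of "c ` topspace X" d X] by simp
  moreover have "continuous_map X ?Y c"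
  proof (rule continuous_map_pullback')
    show "continuous_map X X (d \<circ> c)"
      by (rule continuous_map_eq[OF continuous_map_id]) (simp add: assms)
  qed auto
  ultimately show "homeomorphic_maps ?Y X d c"
    using assms Y by (auto simp: homeomorphic_maps_def)
qed

text \<open>In a Hausdorff space, a point of the closure of \<open>D\<close> is determined by the traces of its
  neighbourhoods on \<open>D\<close>.\<close>

lemma closure_of_lepoll:
  assumes "Hausdorff_space X"
  shows "X closure_of D \<lesssim> Pow (Pow D)"
proof -
  define t where "t x = {U \<inter> D |U. openin X U \<and> x \<in> U}" for x
  have "x = y" if "x \<in> X closure_of D" "y \<in> X closure_of D" "t x = t y" for x y
  proof (rule ccontr)
    assume "x \<noteq> y"
    moreover have "x \<in> topspace X" "y \<in> topspace X"
      using that by (simp_all add: in_closure_of)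
    ultimately obtain U V where UV: "openin X U" "openin X V" "x \<in> U" "y \<in> V" "disjnt U V"
      using assms unfolding Hausdorff_space_def by blast
    then have "U \<inter> D \<in> t y"
      using that(3) unfolding t_def by blast
    \<comment> \<open>Equal traces give a neighbourhood \<open>W\<close> of \<open>y\<close> that
      meets \<open>D\<close> in the same points as \<open>U\<close>; a point of \<open>D\<close> in
      \<open>V \<inter> W\<close> then lies in both \<open>U\<close> and \<open>V\<close>.\<close>
    then obtain W where W: "openin X W" "y \<in> W" "U \<inter> D = W \<inter> D"
      unfolding t_def by blast
    then have "openin X (V \<inter> W)" "y \<in> V \<inter> W"
      using UV by auto
    then obtain d where "d \<in> D" "d \<in> V \<inter> W"
      using \<open>y \<in> X closure_of D\<close> unfolding in_closure_of by metis
    then show False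
      using W UV(5) unfolding disjnt_def by blast
  qed
  then have "inj_on t (X closure_of D)"
    by (rule inj_onI)
  moreover have "t ` (X closure_of D) \<subseteq> Pow (Pow D)"
    by (auto simp: t_def)
  ultimately show ?thesis
    unfolding lepoll_def by blast
qed

text \<open>The part common to Tychonoff and compact spaces. \<open>S\<close> may be anything
  between the image of \<open>A\<close> and its closure: containing the image it receives
  \<open>e\<close>, and lying in the closure it makes \<open>e\<close> epic for maps into Hausdorff
  spaces. Membership in \<open>obs\<close> and stability of \<open>S\<close> under endomorphisms are
  left to the two instances.\<close>

lemma top_factorization:
  fixes M :: "'i \<Rightarrow> 'u topology" and c :: "('i \<Rightarrow> 'u) \<Rightarrow> 'u" and f :: "'i \<Rightarrow> 'u \<Rightarrow> 'u"
    and I :: "'i set"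
  defines "Q \<equiv> product_topology M I"
    and "\<phi> \<equiv> \<lambda>a. restrict (\<lambda>i. f i a) I"
  assumes \<phi>S: "\<phi> ` A \<subseteq> S" and dense: "S \<subseteq> Q closure_of (\<phi> ` A)" and c: "inj_on c S"
    and obs: "pullback_topology (c ` S) (inv_into S c) (subtopology Q S) \<in> obs"
    and Hausdorff: "\<And>Y. Y \<in> obs \<Longrightarrow> Hausdorff_space Y"
    and endo: "\<And>u y. (\<And>i. i \<in> I \<Longrightarrow> continuous_map (M i) (M i) (u i)) \<Longrightarrow>
      (\<And>x. x \<in> A \<Longrightarrow> \<exists>y\<in>A. \<forall>i\<in>I. u i (f i x) = f i y) \<Longrightarrow> y \<in> S \<Longrightarrow>
      restrict (\<lambda>i. u i (y i)) I \<in> S"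
  shows "factorization obs topspace continuous_map A I M f
    (pullback_topology (c ` S) (inv_into S c) (subtopology Q S)) (\<lambda>x. c (\<phi> x)) (\<lambda>i x. inv_into S c x i)"
proof -
  let ?d = "inv_into S c"
  let ?L = "pullback_topology (c ` S) ?d (subtopology Q S)"
  have SQ: "S \<subseteq> topspace Q"
    using dense closure_of_subset_topspace by (rule subset_trans)
  then have topS: "topspace (subtopology Q S) = S"
    by auto
  have d: "?d (c y) = y" if "y \<in> S" for y
    using c that by simp
  have hom: "homeomorphic_maps ?L (subtopology Q S) ?d c" and L: "topspace ?L = c ` S"
    using pullback_homeomorphic[of "subtopology Q S" ?d c] d by (simp_all only: topS)
  have d_cont: "continuous_map ?L (subtopology Q S) ?d" and c_cont: "continuous_map (subtopology Q S) ?L c"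
    using hom by (auto simp: homeomorphic_maps_def)
  have S_ext: "y \<in> extensional I" if "y \<in> S" for y
    using SQ that by (auto simp: Q_def PiE_def)
  \<comment> \<open>\<open>h\<close> is \<open>c\<close> after the decoded map, and a map into the
    product is continuous as soon as its components are.\<close>
  have init: "continuous_map Y ?L h"
    if h: "h \<in> topspace Y \<rightarrow> topspace ?L"
      and comp: "\<And>i. i \<in> I \<Longrightarrow> continuous_map Y (M i) (\<lambda>y. ?d (h y) i)" for Y :: "'u topology" and h
  proof -
    have dh: "?d (h y) \<in> S" "c (?d (h y)) = h y" if "y \<in> topspace Y" for y
    proof -
      have "h y \<in> c ` S"
        using h that unfolding L by blast
      then show "?d (h y) \<in> S" "c (?d (h y)) = h y"
        by (rule inv_into_into, rule f_inv_into_f)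
    qed
    have "continuous_map Y Q (\<lambda>y. ?d (h y))"
      unfolding Q_def continuous_map_componentwise using comp dh S_ext by auto
    then have "continuous_map Y (subtopology Q S) (\<lambda>y. ?d (h y))"
      using dh by (auto simp: continuous_map_in_subtopology)
    then have "continuous_map Y ?L (c \<circ> (\<lambda>y. ?d (h y)))"
      using c_cont by (rule continuous_map_compose)
    then show ?thesis
      by (rule continuous_map_eq) (simp add: dh)
  qed
  show ?thesis
  proof
    show "?L \<in> obs"
      by (rule obs)
    show "c (\<phi> x) \<in> topspace ?L" if "x \<in> A" for x
      using \<phi>S that unfolding L by blast
    show "continuous_map ?L (M i) (\<lambda>x. ?d x i)" if "i \<in> I" for i
    proof -
      have "continuous_map ?L (product_topology M I) ?d"
        using d_cont unfolding continuous_map_in_subtopology Q_def by blast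
      then show ?thesis
        using that unfolding continuous_map_componentwise by blast
    qed
    show "?d (c (\<phi> x)) i = f i x" if "i \<in> I" "x \<in> A" for i x
    proof -
      have "\<phi> x \<in> S"
        using \<phi>S that by blast
      then show ?thesis
        using that by (simp add: d) (simp add: \<phi>_def)
    qed
    show "x = y" if "x \<in> topspace ?L" "y \<in> topspace ?L" "\<And>i. i \<in> I \<Longrightarrow> ?d x i = ?d y i" for x y
    proof -
      have "?d x = ?d y"
        using that S_ext by (intro extensionalityI[of _ I]) (auto simp: L d)
      then show ?thesis
        using that(1,2) unfolding L by (metis f_inv_into_f)
    qed
    show "continuous_map Y ?L h"
      if "Y \<in> obs" "h \<in> topspace Y \<rightarrow> topspace ?L"
        "\<And>i. i \<in> I \<Longrightarrow> continuous_map Y (M i) (\<lambda>y. ?d (h y) i)" for Y h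
      using that by (intro init) auto
    show "h x = k x"
      if "Y \<in> obs" "continuous_map ?L Y h" "continuous_map ?L Y k"
        "\<And>x. x \<in> A \<Longrightarrow> h (c (\<phi> x)) = k (c (\<phi> x))" "x \<in> topspace ?L" for Y h k x
    proof -
      obtain y where y: "y \<in> S" "x = c y"
        using \<open>x \<in> topspace ?L\<close> unfolding L by blast
      \<comment> \<open>The image of \<open>A\<close> is dense in \<open>S\<close>, and continuous
        maps into a Hausdorff space that agree on a dense set coincide.\<close>
      have "y \<in> subtopology Q S closure_of (\<phi> ` A)"
        using y dense \<phi>S by (auto simp: closure_of_subtopology Int_absorb1)
      then have "(h \<circ> c) y = (k \<circ> c) y"
        by (rule forall_in_closure_of_eq[OF _ Hausdorff[OF that(1)] continuous_map_compose[OF c_cont that(2)]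
              continuous_map_compose[OF c_cont that(3)]]) (auto simp: that(4))
      then show ?thesis
        using y by simp
    qed
    show "\<exists>y\<in>topspace ?L. \<forall>i\<in>I. ?d y i = u i (?d x i)"
      if "\<And>i. i \<in> I \<Longrightarrow> continuous_map (M i) (M i) (u i)"
        "\<And>x. x \<in> A \<Longrightarrow> \<exists>y\<in>A. \<forall>i\<in>I. u i (f i x) = f i y" "x \<in> topspace ?L" for u x
    proof -
      have "?d x \<in> S"
        using that(3) unfolding L by (rule inv_into_into)
      then have "restrict (\<lambda>i. u i (?d x i)) I \<in> S"
        using endo[of u] that by blast
      then show ?thesis
        unfolding L by (intro bexI[of _ "c (restrict (\<lambda>i. u i (?d x i)) I)"]) (auto simp: d)
    qed
  qed
qed

text \<open>The image of \<open>A\<close> itself can serve as \<open>S\<close>: complete regularity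
  and the Hausdorff property pass to arbitrary products and to subspaces, and stability under
  endomorphisms can be read off on \<open>A\<close>.\<close>

lemma Tych_factorization:
  fixes A :: "'u set" and M :: "'i \<Rightarrow> 'u topology"
  assumes "universe TYPE('u)" "small A"
    and M: "\<And>i. i \<in> I \<Longrightarrow> M i \<in> Ob Tych" and f: "\<And>i. i \<in> I \<Longrightarrow> f i \<in> A \<rightarrow> topspace (M i)"
  shows "\<exists>L e p. factorization (Ob Tych) topspace continuous_map A I M f L e p"
proof -
  define Q where "Q = product_topology M I"
  define \<phi> where "\<phi> = (\<lambda>a. restrict (\<lambda>i. f i a) I)"
  \<comment> \<open>A generous bound, put in the double power set form that
    \<open>small_copy\<close> expects.\<close>
  have "\<phi> ` A \<lesssim> Pow (Pow A)"
    using image_lepoll lepoll_Pow_self lepoll_trans by meson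
  then obtain c :: "('i \<Rightarrow> 'u) \<Rightarrow> 'u" where c: "inj_on c (\<phi> ` A)" "small (c ` (\<phi> ` A))"
    using small_copy[OF assms(1,2)] by blast
  let ?Z = "subtopology Q (\<phi> ` A)"
  let ?L = "pullback_topology (c ` (\<phi> ` A)) (inv_into (\<phi> ` A) c) ?Z"
  have sub: "\<phi> ` A \<subseteq> topspace Q"
    using f by (fastforce simp: Q_def \<phi>_def)
  then have topZ: "topspace ?Z = \<phi> ` A"
    by auto
  have Z: "completely_regular_space ?Z" "Hausdorff_space ?Z"
    using M unfolding Q_def Tych_def concrete_cat_def
    by (auto intro!: completely_regular_space_subtopology Hausdorff_space_subtopology
        simp: completely_regular_space_product_topology Hausdorff_space_product_topology)
  have L: "topspace ?L = c ` (\<phi> ` A)" "?L homeomorphic_space ?Z"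
    using pullback_homeomorphic[of ?Z "inv_into (\<phi> ` A) c" c] c unfolding topZ homeomorphic_space_def
    by auto
  have obs: "?L \<in> Ob Tych"
    unfolding Tych_def concrete_cat_def
    using Z L(1) c(2) homeomorphic_completely_regular_space[OF L(2)] homeomorphic_Hausdorff_space[OF L(2)]
    by simp
  have "factorization (Ob Tych) topspace continuous_map A I M f ?L
      (\<lambda>x. c (\<phi> x)) (\<lambda>i x. inv_into (\<phi> ` A) c x i)"
    unfolding Q_def \<phi>_def
  proof (rule top_factorization, fold \<phi>_def Q_def)
    show "\<phi> ` A \<subseteq> Q closure_of (\<phi> ` A)"
      using closure_of_subset[OF sub] .
    show "Hausdorff_space Y" if "Y \<in> Ob Tych" for Y :: "'u topology"
      using that by (simp add: Tych_def concrete_cat_def)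
    show "restrict (\<lambda>i. u i (y i)) I \<in> \<phi> ` A"
      if uA: "\<And>x. x \<in> A \<Longrightarrow> \<exists>y\<in>A. \<forall>i\<in>I. u i (f i x) = f i y" and "y \<in> \<phi> ` A" for u y
    proof -
      obtain x where "x \<in> A" "y = \<phi> x"
        using \<open>y \<in> \<phi> ` A\<close> by blast
      moreover then obtain z where "z \<in> A" "\<forall>i\<in>I. u i (f i x) = f i z"
        using uA by blast
      ultimately have "restrict (\<lambda>i. u i (y i)) I = \<phi> z"
        by (auto simp: \<phi>_def)
      then show ?thesis
        using \<open>z \<in> A\<close> by blast
    qed
  qed (use c obs in auto)
  then show ?thesis
    by blast
qed

text \<open>The product is compact by Tychonoff's theorem, hence so is the closure of the image. Its
  points need not come from \<open>A\<close>, so its size is bounded through neighbourhood traces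
  and its stability is shown through continuity.\<close>

lemma Comp_factorization:
  fixes A :: "'u set" and M :: "'i \<Rightarrow> 'u topology"
  assumes "universe TYPE('u)" "small A"
    and M: "\<And>i. i \<in> I \<Longrightarrow> M i \<in> Ob Comp" and f: "\<And>i. i \<in> I \<Longrightarrow> f i \<in> A \<rightarrow> topspace (M i)"
  shows "\<exists>L e p. factorization (Ob Comp) topspace continuous_map A I M f L e p"
proof -
  define Q where "Q = product_topology M I"
  define \<phi> where "\<phi> = (\<lambda>a. restrict (\<lambda>i. f i a) I)"
  define S where "S = Q closure_of (\<phi> ` A)"
  have Q: "compact_space Q" "Hausdorff_space Q"
    using M unfolding Q_def Comp_def concrete_cat_def
    by (auto simp: compact_space_product_topology Hausdorff_space_product_topology)
  have "Pow (Pow (\<phi> ` A)) \<lesssim> Pow (Pow A)"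
    by (metis Pow_mono image_Pow_surj image_lepoll)
  then have "S \<lesssim> Pow (Pow A)"
    unfolding S_def using closure_of_lepoll[OF Q(2)] lepoll_trans by blast
  then obtain c :: "('i \<Rightarrow> 'u) \<Rightarrow> 'u" where c: "inj_on c S" "small (c ` S)"
    using small_copy[OF assms(1,2)] by blast
  let ?Z = "subtopology Q S"
  let ?L = "pullback_topology (c ` S) (inv_into S c) ?Z"
  have sub: "\<phi> ` A \<subseteq> topspace Q"
    using f by (fastforce simp: Q_def \<phi>_def)
  have topZ: "topspace ?Z = S"
    using closure_of_subset_topspace[of Q] by (auto simp: S_def)
  have Z: "compact_space ?Z" "Hausdorff_space ?Z"
    using Q closedin_compact_space[of Q S] Hausdorff_space_subtopology
    by (auto intro!: compact_space_subtopology simp: S_def)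
  have L: "topspace ?L = c ` S" "?L homeomorphic_space ?Z"
    using pullback_homeomorphic[of ?Z "inv_into S c" c] c unfolding topZ homeomorphic_space_def
    by auto
  have obs: "?L \<in> Ob Comp"
    unfolding Comp_def concrete_cat_def
    using Z L(1) c(2) homeomorphic_compact_space[OF L(2)] homeomorphic_Hausdorff_space[OF L(2)]
    by simp
  have "factorization (Ob Comp) topspace continuous_map A I M f ?L
      (\<lambda>x. c (\<phi> x)) (\<lambda>i x. inv_into S c x i)"
    unfolding Q_def \<phi>_def
  proof (rule top_factorization, fold \<phi>_def Q_def)
    show "\<phi> ` A \<subseteq> S" "S \<subseteq> Q closure_of (\<phi> ` A)"
      unfolding S_def using closure_of_subset[OF sub] by auto
    show "Hausdorff_space Y" if "Y \<in> Ob Comp" for Y :: "'u topology"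
      using that by (simp add: Comp_def concrete_cat_def)
    show "restrict (\<lambda>i. u i (y i)) I \<in> S"
      if u: "\<And>i. i \<in> I \<Longrightarrow> continuous_map (M i) (M i) (u i)"
        and uA: "\<And>x. x \<in> A \<Longrightarrow> \<exists>y\<in>A. \<forall>i\<in>I. u i (f i x) = f i y" and "y \<in> S" for u y
    proof -
      \<comment> \<open>The endomorphisms \<open>u i\<close> act coordinatewise on the whole
        product. This map is continuous and sends the image of \<open>A\<close> into itself, hence
        also the closure.\<close>
      define w where "w = (\<lambda>y. restrict (\<lambda>i. u i (y i)) I)"
      have "continuous_map Q (M i) (\<lambda>y. u i (y i))" if "i \<in> I" for i
        using continuous_map_compose[OF continuous_map_product_projection[OF that, of M] u[OF that]]
        by (simp add: Q_def comp_def)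
      then have "continuous_map Q Q w"
        unfolding w_def by (subst (2) Q_def) (auto simp: continuous_map_componentwise)
      then have "w ` S \<subseteq> Q closure_of (w ` \<phi> ` A)"
        unfolding S_def by (rule continuous_map_image_closure_subset)
      moreover have "w ` \<phi> ` A \<subseteq> \<phi> ` A"
      proof clarify
        fix x assume "x \<in> A"
        then obtain z where "z \<in> A" "\<forall>i\<in>I. u i (f i x) = f i z"
          using uA by blast
        then show "w (\<phi> x) \<in> \<phi> ` A"
          by (intro image_eqI[of _ _ z]) (auto simp: w_def \<phi>_def)
      qed
      ultimately show ?thesis
        using \<open>y \<in> S\<close> closure_of_mono unfolding S_def w_def by blast
    qed
  qed (use c obs in auto)
  then show ?thesis
    by blast
qed

lemma
  fixes T X :: "'u topology"
  assumes "infinite (UNIV :: 'u set)"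
  shows topspace_top_product: "topspace (top_product T X) = upair ` (topspace T \<times> topspace X)"
    and homeomorphic_top_product:
      "homeomorphic_maps (top_product T X) (prod_topology T X) unpair upair"
proof -
  have "unpair (upair q) = q" for q :: "'u \<times> 'u"
    unfolding unpair_def using upair_inj[OF assms] by simp
  then show "topspace (top_product T X) = upair ` (topspace T \<times> topspace X)"
      "homeomorphic_maps (top_product T X) (prod_topology T X) unpair upair"
    using pullback_homeomorphic[of "prod_topology T X" unpair upair]
    unfolding top_product_def topspace_prod_topology by auto
qed

lemma top_action_category:
  fixes G :: "('u, 'b) monoid_scheme"
  assumes "universe TYPE('u)" "topological_group G T"
    and small_obs: "\<And>X. X \<in> obs \<Longrightarrow> small (topspace X)"
    and product_obs: "\<And>X. X \<in> obs \<Longrightarrow> top_product T X \<in> obs"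
    and fact: "\<And>A (I :: ('u topology \<times> ('u \<Rightarrow> 'u) \<times> ('u \<Rightarrow> 'u)) set) M f.
      small A \<Longrightarrow> (\<And>i. i \<in> I \<Longrightarrow> M i \<in> obs) \<Longrightarrow> (\<And>i. i \<in> I \<Longrightarrow> f i \<in> A \<rightarrow> topspace (M i)) \<Longrightarrow>
      \<exists>L e p. factorization obs topspace continuous_map A I M f L e p"
  shows "action_category G obs topspace continuous_map (top_product T)"
proof -
  have inf: "infinite (UNIV :: 'u set)"
    using assms(1) by (simp add: universe_def)
  have G: "group G" "topspace T = carrier G"
    using assms(2) by (simp_all add: topological_group_def)
  have up: "continuous_map (prod_topology T X) (top_product T X) upair"
    and un: "continuous_map (top_product T X) (prod_topology T X) unpair" for X
    using homeomorphic_top_product[OF inf, of T X] by (simp_all add: homeomorphic_maps_def)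
  show ?thesis
  proof (intro action_category.intro action_category_axioms.intro)
    show "continuous_map X (top_product T X) (\<lambda>x. upair (k, x))" if "k \<in> carrier G" for X k
    proof -
      have "continuous_map X (prod_topology T X) (\<lambda>x. (k, x))"
        using that G(2) by (simp add: continuous_map_pairedI)
      from continuous_map_compose[OF this up] show ?thesis
        by (simp add: comp_def)
    qed
    show "continuous_map (top_product T X) (top_product T Y)
        (\<lambda>q. case unpair q of (g, x) \<Rightarrow> upair (g, f x))" if "continuous_map X Y f" for X Y f
    proof -
      have "continuous_map (prod_topology T X) (prod_topology T Y) (\<lambda>(g, x). (g, f x))"
        using that by (simp add: continuous_map_prod_top)
      from continuous_map_compose[OF continuous_map_compose[OF un this] up] show ?thesis
        by (simp add: comp_def split_beta)
    qed
    show "continuous_map X Z (\<lambda>x. g (f x))"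
      if "continuous_map X Y f" "continuous_map Y Z g" for X Y Z :: "'u topology" and f g
      using continuous_map_compose[OF that] by (simp add: comp_def)
  qed (use assms(1) G small_obs product_obs fact topspace_top_product[OF inf] in
      \<open>auto simp: continuous_map_funspace intro: continuous_map_eq dest: continuous_map_image_subset_topspace\<close>)
qed

lemma
  fixes G :: "('u, 'b) monoid_scheme" and T :: "'u topology"
  assumes "universe TYPE('u)"
    and "topological_group G T" and "compact_space T" and "Hausdorff_space T"
    and "small (carrier G)"
  shows Tych_algebras_cocomplete: "small_cocomplete TYPE('u) (EM Tych (top_monad G T))"
    and Comp_algebras_cocomplete: "small_cocomplete TYPE('u) (EM Comp (top_monad G T))"
proof -
  have inf: "infinite (UNIV :: 'u set)"
    using assms(1) by (simp add: universe_def)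
  have prod: "top_product T X homeomorphic_space prod_topology T X" for X
    using homeomorphic_top_product[OF inf] unfolding homeomorphic_space_def by blast
  have small: "small (topspace (top_product T X))" if "small (topspace X)" for X
    unfolding topspace_top_product[OF inf] using assms that
    by (intro small_upair_Sigma) (auto simp: topological_group_def)
  \<comment> \<open>Compactness of \<open>T\<close> enters the Tychonoff case here: it makes the
    Hausdorff space \<open>T\<close> completely regular, so that products with \<open>T\<close>
    remain Tychonoff.\<close>
  have "completely_regular_space T"
    using assms by (simp add: compact_Hausdorff_or_regular_imp_normal_space normal_imp_completely_regular_space)
  have "action_category G (Ob Tych) topspace continuous_map (top_product T)"
  proof (rule top_action_category[OF assms(1,2)])
    show "top_product T X \<in> Ob Tych" if "X \<in> Ob Tych" for X :: "'u topology"
      using that small assms(4) \<open>completely_regular_space T\<close>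
      by (simp add: Tych_def concrete_cat_def homeomorphic_completely_regular_space[OF prod]
          homeomorphic_Hausdorff_space[OF prod] completely_regular_space_prod_topology
          Hausdorff_space_prod_topology)
    show "\<exists>L e p. factorization (Ob Tych) topspace continuous_map A I M f L e p"
      if "small A" "\<And>i. i \<in> I \<Longrightarrow> M i \<in> Ob Tych" "\<And>i. i \<in> I \<Longrightarrow> f i \<in> A \<rightarrow> topspace (M i)"
      for A :: "'u set" and I :: "('u topology \<times> ('u \<Rightarrow> 'u) \<times> ('u \<Rightarrow> 'u)) set" and M f
      using that by (rule Tych_factorization[OF assms(1)])
  qed (auto simp: Tych_def concrete_cat_def)
  from action_category.small_cocomplete_EM[OF this]
  show "small_cocomplete TYPE('u) (EM Tych (top_monad G T))"
    by (simp add: top_monad_def Tych_def concrete_cat_def)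
  have "action_category G (Ob Comp) topspace continuous_map (top_product T)"
  proof (rule top_action_category[OF assms(1,2)])
    show "top_product T X \<in> Ob Comp" if "X \<in> Ob Comp" for X :: "'u topology"
      using that small assms(3,4)
      by (simp add: Comp_def concrete_cat_def homeomorphic_compact_space[OF prod]
          homeomorphic_Hausdorff_space[OF prod] compact_space_prod_topology
          Hausdorff_space_prod_topology)
    show "\<exists>L e p. factorization (Ob Comp) topspace continuous_map A I M f L e p"
      if "small A" "\<And>i. i \<in> I \<Longrightarrow> M i \<in> Ob Comp" "\<And>i. i \<in> I \<Longrightarrow> f i \<in> A \<rightarrow> topspace (M i)"
      for A :: "'u set" and I :: "('u topology \<times> ('u \<Rightarrow> 'u) \<times> ('u \<Rightarrow> 'u)) set" and M f
      using that by (rule Comp_factorization[OF assms(1)])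
  qed (auto simp: Comp_def concrete_cat_def)
  from action_category.small_cocomplete_EM[OF this]
  show "small_cocomplete TYPE('u) (EM Comp (top_monad G T))"
    by (simp add: top_monad_def Comp_def concrete_cat_def)
qed

section \<open>Uniform spaces\<close>

lemma
  assumes "uniform_structure X"
  shows entourages_nonempty: "entourages X \<noteq> {}"
    and entourage_UNIV: "points X \<times> points X \<in> entourages X"
  using assms unfolding uniform_structure_def by (metis ex_in_conv order_refl)+

lemma
  assumes "uniform_structure X" "E \<in> entourages X"
  shows entourage_refl: "x \<in> points X \<Longrightarrow> (x, x) \<in> E"
    and entourage_subset: "E \<subseteq> points X \<times> points X"
    and entourage_mono: "E \<subseteq> D \<Longrightarrow> D \<subseteq> points X \<times> points X \<Longrightarrow> D \<in> entourages X"
    and entourage_Int: "D \<in> entourages X \<Longrightarrow> E \<inter> D \<in> entourages X"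
    and entourage_converse: "E\<inverse> \<in> entourages X"
    and entourage_half: "\<exists>D\<in>entourages X. D O D \<subseteq> E"
  using assms unfolding uniform_structure_def by (blast | simp)+

lemma entourage_INT:
  assumes "uniform_structure X" "finite K" "\<And>i. i \<in> K \<Longrightarrow> E i \<in> entourages X"
  shows "(points X \<times> points X) \<inter> (\<Inter>i\<in>K. E i) \<in> entourages X"
  using assms(2,3)
proof (induction K rule: finite_induct)
  case empty
  then show ?case
    using entourage_UNIV[OF assms(1)] by simp
next
  case (insert i K)
  then have "E i \<in> entourages X" "(points X \<times> points X) \<inter> (\<Inter>i\<in>K. E i) \<in> entourages X"
    by simp_all
  then have "E i \<inter> ((points X \<times> points X) \<inter> (\<Inter>i\<in>K. E i)) \<in> entourages X"
    by (rule entourage_Int[OF assms(1)])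
  then show ?case
    by (simp add: Int_ac)
qed

lemma symmetric_entourage_half:
  assumes "uniform_structure X" "E \<in> entourages X"
  obtains D where "D \<in> entourages X" "D O D \<subseteq> E" "sym D"
proof -
  obtain D where D: "D \<in> entourages X" "D O D \<subseteq> E"
    using entourage_half assms by blast
  have "D \<inter> D\<inverse> \<in> entourages X"
    using D(1) assms(1) by (simp add: entourage_Int entourage_converse)
  moreover have "(D \<inter> D\<inverse>) O (D \<inter> D\<inverse>) \<subseteq> E"
    using D(2) by blast
  ultimately show thesis
    using that[of "D \<inter> D\<inverse>"] by (auto simp: sym_def)
qed

lemma openin_unif_topology:
  assumes "uniform_structure X"
  shows "openin (unif_topology X) U \<longleftrightarrow> U \<subseteq> points X \<and> (\<forall>x\<in>U. \<exists>E\<in>entourages X. E `` {x} \<subseteq> U)"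
proof -
  have "istopology (\<lambda>U. U \<subseteq> points X \<and> (\<forall>x\<in>U. \<exists>E\<in>entourages X. E `` {x} \<subseteq> U))"
    unfolding istopology_def
  proof (intro conjI allI impI ballI)
    fix U V x assume U: "U \<subseteq> points X \<and> (\<forall>x\<in>U. \<exists>E\<in>entourages X. E `` {x} \<subseteq> U)"
      and V: "V \<subseteq> points X \<and> (\<forall>x\<in>V. \<exists>E\<in>entourages X. E `` {x} \<subseteq> V)" and x: "x \<in> U \<inter> V"
    obtain E where E: "E \<in> entourages X" "E `` {x} \<subseteq> U"
      using U x by blast
    obtain D where D: "D \<in> entourages X" "D `` {x} \<subseteq> V"
      using V x by blast
    have "E \<inter> D \<in> entourages X" "(E \<inter> D) `` {x} \<subseteq> U \<inter> V"
      using E D entourage_Int[OF assms] by auto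
    then show "\<exists>E\<in>entourages X. E `` {x} \<subseteq> U \<inter> V"
      by blast
  next
    fix \<K> x assume "\<forall>K\<in>\<K>. K \<subseteq> points X \<and> (\<forall>x\<in>K. \<exists>E\<in>entourages X. E `` {x} \<subseteq> K)" "x \<in> \<Union>\<K>"
    then show "\<exists>E\<in>entourages X. E `` {x} \<subseteq> \<Union>\<K>"
      by (meson Union_upper UnionE order_trans)
  qed auto
  then show ?thesis
    unfolding unif_topology_def by (simp add: topology_inverse')
qed

lemma topspace_unif_topology:
  assumes "uniform_structure X"
  shows "topspace (unif_topology X) = points X"
proof -
  have "openin (unif_topology X) (points X)"
    using entourage_UNIV[OF assms] by (auto simp: openin_unif_topology[OF assms])
  then show ?thesis
    using openin_unif_topology[OF assms] by (meson openin_subset openin_topspace subset_antisym)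
qed

text \<open>An entourage ball need not be open. The set of points that have a whole ball inside it
  is open, because an entourage can be halved.\<close>

lemma entourage_ball_interior:
  assumes "uniform_structure X" "E \<in> entourages X" "x \<in> points X"
  shows "\<exists>U. openin (unif_topology X) U \<and> x \<in> U \<and> U \<subseteq> E `` {x}"
proof -
  let ?U = "{y \<in> points X. \<exists>D\<in>entourages X. D `` {y} \<subseteq> E `` {x}}"
  have "openin (unif_topology X) ?U"
    unfolding openin_unif_topology[OF assms(1)]
  proof (intro conjI ballI)
    fix y assume "y \<in> ?U"
    then obtain D where "D \<in> entourages X" "D `` {y} \<subseteq> E `` {x}"
      by blast
    moreover then obtain C where "C \<in> entourages X" "C O C \<subseteq> D"
      using entourage_half[OF assms(1)] by blast
    moreover then have "C \<subseteq> points X \<times> points X"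
      using entourage_subset[OF assms(1)] by blast
    ultimately show "\<exists>C\<in>entourages X. C `` {y} \<subseteq> ?U"
      by (intro bexI[of _ C]) blast+
  qed auto
  moreover have "x \<in> ?U"
    using assms by blast
  moreover have "?U \<subseteq> E `` {x}"
    using entourage_refl[OF assms(1)] by blast
  ultimately show ?thesis
    by blast
qed

lemma Hausdorff_imp_separated:
  assumes "uniform_structure X" "Hausdorff_space (unif_topology X)"
  shows "separated X"
  unfolding separated_def
proof (rule subset_antisym)
  show "Id_on (points X) \<subseteq> \<Inter>(entourages X)"
    using entourage_refl[OF assms(1)] by auto
  show "\<Inter>(entourages X) \<subseteq> Id_on (points X)"
  proof (rule subrelI, rule ccontr)
    fix x y assume xy: "(x, y) \<in> \<Inter>(entourages X)" "(x, y) \<notin> Id_on (points X)"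
    then have "x \<in> points X" "y \<in> points X"
      using entourages_nonempty[OF assms(1)] entourage_subset[OF assms(1)] by blast+
    moreover then have "x \<noteq> y"
      using xy(2) by auto
    ultimately obtain U V where "openin (unif_topology X) U" "x \<in> U" "y \<in> V" "disjnt U V"
      using assms(2) unfolding Hausdorff_space_def topspace_unif_topology[OF assms(1)] by blast
    moreover then obtain E where "E \<in> entourages X" "E `` {x} \<subseteq> U"
      unfolding openin_unif_topology[OF assms(1)] by blast
    ultimately show False
      using xy(1) unfolding disjnt_def by blast
  qed
qed

section \<open>Initial uniformities\<close>

text \<open>The coarsest uniformity that makes every \<open>p i\<close> uniformly continuous. It is
  used for the vertex of the colimit, for the product with \<open>G\<close> (two projections) and
  for uniformizing a completely regular space (all continuous real functions). The case of empty
  \<open>K\<close> provides an entourage even when \<open>I\<close> is empty.\<close>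

definition initial_unif :: "'a set \<Rightarrow> 'i set \<Rightarrow> ('i \<Rightarrow> 'c unif) \<Rightarrow> ('i \<Rightarrow> 'a \<Rightarrow> 'c) \<Rightarrow> 'a unif" where
  "initial_unif S I M p =
     \<lparr> points = S,
       entourages = {E. E \<subseteq> S \<times> S \<and> (\<exists>K V. finite K \<and> K \<subseteq> I \<and> (\<forall>i\<in>K. V i \<in> entourages (M i)) \<and>
         {(x, y) \<in> S \<times> S. \<forall>i\<in>K. (p i x, p i y) \<in> V i} \<subseteq> E)} \<rparr>"

lemma points_initial_unif [simp]: "points (initial_unif S I M p) = S"
  by (simp add: initial_unif_def)

lemma entourage_initial_unif:
  "E \<in> entourages (initial_unif S I M p) \<longleftrightarrow>
     E \<subseteq> S \<times> S \<and> (\<exists>K V. finite K \<and> K \<subseteq> I \<and> (\<forall>i\<in>K. V i \<in> entourages (M i)) \<and>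
       {(x, y) \<in> S \<times> S. \<forall>i\<in>K. (p i x, p i y) \<in> V i} \<subseteq> E)"
  by (simp add: initial_unif_def)

lemma entourage_initial_unifI:
  assumes "finite K" "K \<subseteq> I" "\<And>i. i \<in> K \<Longrightarrow> V i \<in> entourages (M i)"
  shows "{(x, y) \<in> S \<times> S. \<forall>i\<in>K. (p i x, p i y) \<in> V i} \<in> entourages (initial_unif S I M p)"
  unfolding entourage_initial_unif using assms by blast

lemma uniform_initial_unif:
  assumes M: "\<And>i. i \<in> I \<Longrightarrow> uniform_structure (M i)"
    and p: "\<And>i x. i \<in> I \<Longrightarrow> x \<in> S \<Longrightarrow> p i x \<in> points (M i)"
  shows "uniform_structure (initial_unif S I M p)"
proof -
  let ?X = "initial_unif S I M p"
  define B where "B K V = {(x, y) \<in> S \<times> S. \<forall>i\<in>K. (p i x, p i y) \<in> V i}" for K V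
  have ent: "E \<in> entourages ?X \<longleftrightarrow> E \<subseteq> S \<times> S \<and>
      (\<exists>K V. finite K \<and> K \<subseteq> I \<and> (\<forall>i\<in>K. V i \<in> entourages (M i)) \<and> B K V \<subseteq> E)" for E
    by (simp add: entourage_initial_unif B_def)
  have BI: "B K V \<in> entourages ?X"
    if "finite K" "K \<subseteq> I" "\<And>i. i \<in> K \<Longrightarrow> V i \<in> entourages (M i)" for K V
    unfolding B_def using that by (rule entourage_initial_unifI)
  have mono: "D \<in> entourages ?X" if "E \<in> entourages ?X" "E \<subseteq> D" "D \<subseteq> S \<times> S" for E D
  proof -
    from that(1) obtain K V where "finite K" "K \<subseteq> I" "\<forall>i\<in>K. V i \<in> entourages (M i)" "B K V \<subseteq> E"
      unfolding ent by blast
    moreover from this have "B K V \<subseteq> D"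
      using that(2) by simp
    ultimately show ?thesis
      unfolding ent using that(3) by blast
  qed
  show ?thesis
    unfolding uniform_structure_def points_initial_unif
  proof (intro conjI ballI allI impI)
    show "entourages ?X \<noteq> {}"
      using BI[of "{}"] by auto
  next
    fix E assume "E \<in> entourages ?X"
    then obtain K V where E: "E \<subseteq> S \<times> S" and K: "finite K" "K \<subseteq> I"
      and V: "\<And>i. i \<in> K \<Longrightarrow> V i \<in> entourages (M i)" and BE: "B K V \<subseteq> E"
      unfolding ent by blast
    show "E \<subseteq> S \<times> S"
      by (rule E)
    have "(x, x) \<in> B K V" if "x \<in> S" for x
      using that K V entourage_refl[OF M] p by (auto simp: B_def subset_iff)
    then show "Id_on S \<subseteq> E"
      using BE by auto
    have "B K (\<lambda>i. (V i)\<inverse>) \<in> entourages ?X"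
      using K V entourage_converse[OF M] by (intro BI) auto
    moreover have "B K (\<lambda>i. (V i)\<inverse>) \<subseteq> E\<inverse>"
      using BE by (auto simp: B_def)
    ultimately show "E\<inverse> \<in> entourages ?X"
      by (rule mono) (use E in blast)
    have "\<forall>i\<in>K. \<exists>D. D \<in> entourages (M i) \<and> D O D \<subseteq> V i"
      using K V entourage_half[OF M] by blast
    then obtain D where D: "\<And>i. i \<in> K \<Longrightarrow> D i \<in> entourages (M i)" "\<And>i. i \<in> K \<Longrightarrow> D i O D i \<subseteq> V i"
      by metis
    have "B K D O B K D \<subseteq> B K V"
      using D(2) by (fastforce simp: B_def)
    then show "\<exists>D\<in>entourages ?X. D O D \<subseteq> E"
      using BI[OF K D(1)] BE by (intro bexI[of _ "B K D"]) (auto simp: subset_iff)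
  next
    fix E D assume "E \<in> entourages ?X" "E \<subseteq> D \<and> D \<subseteq> S \<times> S"
    then show "D \<in> entourages ?X"
      using mono by blast
  next
    fix E D assume E: "E \<in> entourages ?X" and D: "D \<in> entourages ?X"
    obtain K V where K: "finite K" "K \<subseteq> I" "\<And>i. i \<in> K \<Longrightarrow> V i \<in> entourages (M i)" "B K V \<subseteq> E"
      using E unfolding ent by blast
    obtain L W where L: "finite L" "L \<subseteq> I" "\<And>i. i \<in> L \<Longrightarrow> W i \<in> entourages (M i)" "B L W \<subseteq> D"
      using D unfolding ent by blast
    \<comment> \<open>\<open>V\<close> and \<open>W\<close> are controlled only on their own finite
      index sets; filling up with the total entourage lets both be used on
      \<open>K \<union> L\<close>.\<close>
    define V' where "V' i = (if i \<in> K then V i else points (M i) \<times> points (M i))" for i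
    define W' where "W' i = (if i \<in> L then W i else points (M i) \<times> points (M i))" for i
    have "V' i \<in> entourages (M i)" "W' i \<in> entourages (M i)" if "i \<in> I" for i
      using K(3) L(3) entourage_UNIV[OF M[OF that]] by (auto simp: V'_def W'_def)
    then have "B (K \<union> L) (\<lambda>i. V' i \<inter> W' i) \<in> entourages ?X"
      using K(1,2) L(1,2) entourage_Int[OF M] by (intro BI) auto
    moreover have "B (K \<union> L) (\<lambda>i. V' i \<inter> W' i) \<subseteq> B K V \<inter> B L W"
      by (auto simp: B_def V'_def W'_def)
    moreover have "E \<subseteq> S \<times> S"
      using E unfolding ent by blast
    ultimately show "E \<inter> D \<in> entourages ?X"
      using K(4) L(4) by (elim mono) auto
  qed
qed

lemma unif_continuous_initial_proj:
  assumes "i \<in> I" "\<And>x. x \<in> S \<Longrightarrow> p i x \<in> points (M i)"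
  shows "unif_continuous (initial_unif S I M p) (M i) (p i)"
  unfolding unif_continuous_def
  using assms entourage_initial_unifI[of "{i}" I _ M S p] by auto

lemma unif_continuous_initialI:
  assumes X: "uniform_structure X" and h: "h \<in> points X \<rightarrow> S"
    and comp: "\<And>i. i \<in> I \<Longrightarrow> unif_continuous X (M i) (\<lambda>x. p i (h x))"
  shows "unif_continuous X (initial_unif S I M p) h"
  unfolding unif_continuous_def points_initial_unif
proof (intro conjI ballI h)
  fix E assume "E \<in> entourages (initial_unif S I M p)"
  then obtain K V where K: "finite K" "K \<subseteq> I" and V: "\<And>i. i \<in> K \<Longrightarrow> V i \<in> entourages (M i)"
    and BE: "{(x, y) \<in> S \<times> S. \<forall>i\<in>K. (p i x, p i y) \<in> V i} \<subseteq> E"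
    unfolding entourage_initial_unif by blast
  define W where "W i = {(x, y) \<in> points X \<times> points X. (p i (h x), p i (h y)) \<in> V i}" for i
  have "(points X \<times> points X) \<inter> (\<Inter>i\<in>K. W i) \<in> entourages X"
    using comp K V unfolding W_def unif_continuous_def
    by (intro entourage_INT[OF X]) (auto simp: subset_iff)
  then show "{(x, y) \<in> points X \<times> points X. (h x, h y) \<in> E} \<in> entourages X"
    by (rule entourage_mono[OF X]) (use h BE in \<open>auto simp: W_def\<close>)
qed

section \<open>The unique uniformity of a compact Hausdorff space\<close>

definition real_unif :: "real unif" where
  "real_unif = \<lparr> points = UNIV, entourages = {E. \<exists>\<epsilon>>0. {(x, y). \<bar>x - y\<bar> < \<epsilon>} \<subseteq> E} \<rparr>"

lemma uniform_real_unif: "uniform_structure real_unif"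
proof -
  define B where "B \<epsilon> = {(x, y). \<bar>x - y\<bar> < \<epsilon>}" for \<epsilon> :: real
  have ent: "E \<in> entourages real_unif \<longleftrightarrow> (\<exists>\<epsilon>>0. B \<epsilon> \<subseteq> E)" for E
    by (simp add: real_unif_def B_def)
  show ?thesis
    unfolding uniform_structure_def
  proof (intro conjI ballI allI impI)
    show "entourages real_unif \<noteq> {}"
      using ent[of UNIV] zero_less_one by blast
  next
    fix E assume "E \<in> entourages real_unif"
    then obtain \<epsilon> where \<epsilon>: "\<epsilon> > 0" "B \<epsilon> \<subseteq> E"
      unfolding ent by blast
    show "Id_on (points real_unif) \<subseteq> E"
      using \<epsilon> by (auto simp: B_def)
    have "B \<epsilon> \<subseteq> E\<inverse>"
      using \<epsilon> by (auto simp: B_def abs_minus_commute)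
    with \<epsilon>(1) show "E\<inverse> \<in> entourages real_unif"
      unfolding ent by blast
    have "B (\<epsilon> / 2) \<in> entourages real_unif"
      unfolding ent using \<epsilon>(1) by (intro exI[of _ "\<epsilon> / 2"]) simp
    moreover have "B (\<epsilon> / 2) O B (\<epsilon> / 2) \<subseteq> B \<epsilon>"
      by (auto simp: B_def abs_if split: if_splits)
    ultimately show "\<exists>D\<in>entourages real_unif. D O D \<subseteq> E"
      using \<epsilon>(2) by (meson order_trans)
  next
    fix E D assume "E \<in> entourages real_unif" "E \<subseteq> D \<and> D \<subseteq> points real_unif \<times> points real_unif"
    then show "D \<in> entourages real_unif"
      unfolding ent by (meson order_trans)
  next
    fix E D assume "E \<in> entourages real_unif" "D \<in> entourages real_unif"
    then obtain \<epsilon> \<delta> where "\<epsilon> > 0" "B \<epsilon> \<subseteq> E" "\<delta> > 0" "B \<delta> \<subseteq> D"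
      unfolding ent by blast
    then have "min \<epsilon> \<delta> > 0" "B (min \<epsilon> \<delta>) \<subseteq> E \<inter> D"
      by (auto simp: B_def)
    then show "E \<inter> D \<in> entourages real_unif"
      unfolding ent by blast
  qed (simp add: real_unif_def)
qed

text \<open>The uniformity is the initial one for all continuous real functions. Their continuity
  makes its open sets open in \<open>T\<close>; complete regularity gives the converse by providing
  enough functions.\<close>

lemma completely_regular_uniformizable:
  assumes "completely_regular_space T"
  shows "\<exists>X. points X = topspace T \<and> uniform_structure X \<and> unif_topology X = T"
proof -
  define C where "C = {f. continuous_map T euclideanreal f}"
  let ?X = "initial_unif (topspace T) C (\<lambda>_. real_unif) (\<lambda>f. f)"
  have X: "uniform_structure ?X"
    by (rule uniform_initial_unif) (simp_all add: uniform_real_unif, simp add: real_unif_def)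
  have "unif_topology ?X = T"
  proof (rule topology_eq[THEN iffD2], intro allI iffI)
    fix U assume "openin (unif_topology ?X) U"
    then have U: "U \<subseteq> topspace T" "\<forall>x\<in>U. \<exists>E\<in>entourages ?X. E `` {x} \<subseteq> U"
      unfolding openin_unif_topology[OF X] by simp_all
    have "\<exists>W. openin T W \<and> x \<in> W \<and> W \<subseteq> U" if xU: "x \<in> U" for x
    proof -
      have x: "x \<in> topspace T"
        using U(1) xU by blast
      obtain E where E: "E \<in> entourages ?X" "E `` {x} \<subseteq> U"
        using U(2) xU by blast
      then obtain K V where K: "finite K" "K \<subseteq> C" and V: "\<forall>f\<in>K. V f \<in> entourages real_unif"
        and KE: "{(x, y) \<in> topspace T \<times> topspace T. \<forall>f\<in>K. (f x, f y) \<in> V f} \<subseteq> E"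
        unfolding entourage_initial_unif by blast
      have "\<forall>f\<in>K. \<exists>\<epsilon>>0. {(x, y). \<bar>x - y\<bar> < \<epsilon>} \<subseteq> V f"
        using V by (simp add: real_unif_def)
      then obtain \<epsilon> where \<epsilon>: "\<And>f. f \<in> K \<Longrightarrow> \<epsilon> f > 0" "\<And>f. f \<in> K \<Longrightarrow> {(x, y). \<bar>x - y\<bar> < \<epsilon> f} \<subseteq> V f"
        by metis
      define W where "W = (\<Inter>f\<in>K. {y \<in> topspace T. f y \<in> ball (f x) (\<epsilon> f)}) \<inter> topspace T"
      have "openin T {y \<in> topspace T. f y \<in> ball (f x) (\<epsilon> f)}" if "f \<in> K" for f
        using K(2) that by (intro openin_continuous_map_preimage[of T euclideanreal]) (auto simp: C_def)
      then have "openin T W"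
        unfolding W_def using K(1) by (intro openin_INT) auto
      moreover have "x \<in> W"
        using x \<epsilon>(1) by (auto simp: W_def)
      moreover have "W \<subseteq> U"
      proof
        fix y assume y: "y \<in> W"
        have "(f x, f y) \<in> V f" if "f \<in> K" for f
          using y that \<epsilon>(2)[OF that] by (auto simp: W_def dist_real_def)
        then have "(x, y) \<in> E"
          using KE x y by (auto simp: W_def)
        then show "y \<in> U"
          using E by blast
      qed
      ultimately show ?thesis
        by blast
    qed
    then show "openin T U"
      by (subst openin_subopen) blast
  next
    fix U assume U: "openin T U"
    have "\<exists>E\<in>entourages ?X. E `` {x} \<subseteq> U" if x: "x \<in> U" for x
    proof -
      have "closedin T (topspace T - U)" "x \<in> topspace T - (topspace T - U)"
        using U x openin_subset by auto
      then obtain f where f: "continuous_map T (top_of_set {0..1::real}) f" "f x = 0"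
          "f ` (topspace T - U) \<subseteq> {1}"
        using assms unfolding completely_regular_space_def by blast
      then have "f \<in> C"
        by (simp add: C_def continuous_map_in_subtopology)
      \<comment> \<open>As \<open>f\<close> is 0 at \<open>x\<close> and 1 outside \<open>U\<close>,
        radius 1 already forces \<open>y\<close> into \<open>U\<close>.\<close>
      then have "{(x, y) \<in> topspace T \<times> topspace T. \<forall>f\<in>{f}. (f x, f y) \<in> {(x, y). \<bar>x - y\<bar> < 1}}
          \<in> entourages ?X" (is "?E \<in> _")
        by (intro entourage_initial_unifI) (auto simp: real_unif_def intro: exI[of _ 1])
      moreover have "?E `` {x} \<subseteq> U"
        using f(2,3) by auto
      ultimately show ?thesis
        by blast
    qed
    then show "openin (unif_topology ?X) U"
      using openin_subset[OF U] by (simp add: openin_unif_topology[OF X])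
  qed
  with X show ?thesis
    by (intro exI[of _ ?X]) simp
qed

text \<open>This is the Heine-Cantor theorem for the identity map, by a Lebesgue number argument:
  around each point some entourage of \<open>B\<close> is fine enough, and finitely many such
  neighbourhoods cover. Used in both directions it gives uniqueness of the uniformity.\<close>

lemma compact_uniformity_le:
  assumes A: "uniform_structure A" and B: "uniform_structure B"
    and top: "unif_topology A = unif_topology B" and comp: "compact_space (unif_topology B)"
  shows "entourages A \<subseteq> entourages B"
proof
  fix E assume E: "E \<in> entourages A"
  have pts: "points A = points B"
    using topspace_unif_topology[OF A] topspace_unif_topology[OF B] top by simp
  obtain D where D: "D \<in> entourages A" "D O D \<subseteq> E" "sym D"
    using symmetric_entourage_half[OF A E] .
  have "\<exists>V W. V \<in> entourages B \<and> openin (unif_topology B) W \<and> x \<in> W \<and>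
      (\<forall>y z. y \<in> W \<and> (y, z) \<in> V \<longrightarrow> (x, y) \<in> D \<and> (x, z) \<in> D)" if x: "x \<in> points B" for x
  proof -
    obtain U where U: "openin (unif_topology B) U" "x \<in> U" "U \<subseteq> D `` {x}"
      using entourage_ball_interior[OF A D(1), of x] x unfolding pts top by blast
    then obtain V where V: "V \<in> entourages B" "V `` {x} \<subseteq> U"
      using openin_unif_topology[OF B] by blast
    \<comment> \<open>Halving \<open>V\<close> leaves room for two steps, from \<open>x\<close> to a
      point \<open>y\<close> of \<open>W\<close> and from \<open>y\<close> on to \<open>z\<close>,
      without leaving the ball of \<open>V\<close> at \<open>x\<close>.\<close>
    obtain V' where V': "V' \<in> entourages B" "V' O V' \<subseteq> V"
      using entourage_half[OF B V(1)] by blast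
    obtain W where W: "openin (unif_topology B) W" "x \<in> W" "W \<subseteq> V' `` {x}"
      using entourage_ball_interior[OF B V'(1) x] by blast
    have "(x, y) \<in> D \<and> (x, z) \<in> D" if "y \<in> W" "(y, z) \<in> V'" for y z
    proof -
      have xy: "(x, y) \<in> V'" and "z \<in> points B"
        using W(3) that entourage_subset[OF B V'(1)] by auto
      then have "(z, z) \<in> V'" "(y, y) \<in> V'"
        using entourage_refl[OF B V'(1)] entourage_subset[OF B V'(1)] by auto
      then have "(x, y) \<in> V" "(x, z) \<in> V"
        using V'(2) xy that(2) by blast+
      then show ?thesis
        using V(2) U(3) by blast
    qed
    then show ?thesis
      using V'(1) W(1,2) by blast
  qed
  then obtain V W where VW: "\<And>x. x \<in> points B \<Longrightarrow> V x \<in> entourages B"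
      "\<And>x. x \<in> points B \<Longrightarrow> openin (unif_topology B) (W x)" "\<And>x. x \<in> points B \<Longrightarrow> x \<in> W x"
      "\<And>x y z. x \<in> points B \<Longrightarrow> y \<in> W x \<Longrightarrow> (y, z) \<in> V x \<Longrightarrow> (x, y) \<in> D \<and> (x, z) \<in> D"
    by metis
  have "\<exists>\<F>. finite \<F> \<and> \<F> \<subseteq> W ` points B \<and> topspace (unif_topology B) \<subseteq> \<Union>\<F>"
    using comp VW(2,3) unfolding compact_space_alt
    by (elim allE[of _ "W ` points B"]) (auto simp: topspace_unif_topology[OF B])
  then obtain K where K: "K \<subseteq> points B" "finite K" "points B \<subseteq> (\<Union>x\<in>K. W x)"
    unfolding topspace_unif_topology[OF B] by (metis finite_subset_image)
  \<comment> \<open>For a pair in this entourage, the first point lies in some \<open>W x\<close> of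
    the finite subcover. Both points are then \<open>D\<close>-close to that \<open>x\<close>, and
    symmetry of \<open>D\<close> puts the pair in \<open>D O D\<close>. The first factor takes care
    of an empty \<open>K\<close>.\<close>
  have "(points B \<times> points B) \<inter> (\<Inter>x\<in>K. V x) \<in> entourages B"
    using K VW(1) by (intro entourage_INT[OF B]) auto
  moreover have "(points B \<times> points B) \<inter> (\<Inter>x\<in>K. V x) \<subseteq> E"
  proof (rule subrelI)
    fix y z assume yz: "(y, z) \<in> (points B \<times> points B) \<inter> (\<Inter>x\<in>K. V x)"
    then obtain x where "x \<in> K" "y \<in> W x"
      using K(3) by blast
    then have "(x, y) \<in> D" "(x, z) \<in> D"
      using VW(4)[of x y z] yz K(1) by blast+
    then show "(y, z) \<in> E"
      using D(2,3) by (meson relcomp.relcompI subsetD symD)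
  qed
  ultimately show "E \<in> entourages B"
    using entourage_mono[OF B] entourage_subset[OF A E] pts by simp
qed

text \<open>The description operator in the definition of \<open>compact_unif\<close> becomes usable
  through existence and uniqueness. Existence holds because compact Hausdorff spaces are completely
  regular; uniqueness is \<open>compact_uniformity_le\<close> in both directions.\<close>

lemma compact_unif:
  assumes "compact_space T" "Hausdorff_space T"
  shows points_compact_unif: "points (compact_unif T) = topspace T"
    and uniform_compact_unif: "uniform_structure (compact_unif T)"
    and separated_compact_unif: "separated (compact_unif T)"
proof -
  have "completely_regular_space T"
    using assms by (simp add: compact_Hausdorff_or_regular_imp_normal_space normal_imp_completely_regular_space)
  then obtain X where X: "points X = topspace T \<and> uniform_structure X \<and> unif_topology X = T"
    using completely_regular_uniformizable by blast
  moreover have "Y = X" if "points Y = topspace T \<and> uniform_structure Y \<and> unif_topology Y = T" for Y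
    using that X compact_uniformity_le[of X Y] compact_uniformity_le[of Y X] assms(1)
    by (intro unif.equality) auto
  ultimately have *: "points (compact_unif T) = topspace T \<and> uniform_structure (compact_unif T) \<and>
      unif_topology (compact_unif T) = T"
    unfolding compact_unif_def by (rule theI)
  then show "points (compact_unif T) = topspace T" "uniform_structure (compact_unif T)"
    by auto
  show "separated (compact_unif T)"
    using * assms(2) by (intro Hausdorff_imp_separated) auto
qed

section \<open>Uniformly continuous maps, products and factorizations\<close>

lemma unif_continuous_id: "uniform_structure X \<Longrightarrow> unif_continuous X X (\<lambda>x. x)"
  unfolding unif_continuous_def
proof (intro conjI ballI)
  fix E assume X: "uniform_structure X" and E: "E \<in> entourages X"
  have "{(x, x') \<in> points X \<times> points X. (x, x') \<in> E} = E"
    using entourage_subset[OF X E] by blast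
  with E show "{(x, x') \<in> points X \<times> points X. (x, x') \<in> E} \<in> entourages X"
    by simp
qed simp

lemma unif_continuous_const:
  assumes "uniform_structure X" "uniform_structure Y" "y \<in> points Y"
  shows "unif_continuous X Y (\<lambda>x. y)"
  unfolding unif_continuous_def
proof (intro conjI ballI)
  fix E assume E: "E \<in> entourages Y"
  have "{(x, x') \<in> points X \<times> points X. (y, y) \<in> E} = points X \<times> points X"
    using entourage_refl[OF assms(2) E assms(3)] by blast
  then show "{(x, x') \<in> points X \<times> points X. (y, y) \<in> E} \<in> entourages X"
    using entourage_UNIV[OF assms(1)] by simp
qed (use assms in simp)

lemma unif_continuous_compose:
  assumes "unif_continuous X Y f" "unif_continuous Y Z g"
  shows "unif_continuous X Z (\<lambda>x. g (f x))"
  unfolding unif_continuous_def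
proof (intro conjI ballI)
  show "(\<lambda>x. g (f x)) \<in> points X \<rightarrow> points Z"
    using assms unfolding unif_continuous_def by blast
  fix E assume E: "E \<in> entourages Z"
  define D where "D = {(y, y') \<in> points Y \<times> points Y. (g y, g y') \<in> E}"
  have "D \<in> entourages Y"
    using assms(2) E unfolding unif_continuous_def D_def by blast
  then have "{(x, x') \<in> points X \<times> points X. (f x, f x') \<in> D} \<in> entourages X"
    using assms(1) unfolding unif_continuous_def by blast
  moreover have "{(x, x') \<in> points X \<times> points X. (f x, f x') \<in> D}
      = {(x, x') \<in> points X \<times> points X. (g (f x), g (f x')) \<in> E}"
    using assms(1) unfolding unif_continuous_def D_def by blast
  ultimately show "{(x, x') \<in> points X \<times> points X. (g (f x), g (f x')) \<in> E} \<in> entourages X"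
    by simp
qed

lemma unif_continuous_cong:
  assumes "unif_continuous X Y f" "\<And>x. x \<in> points X \<Longrightarrow> f x = g x"
  shows "unif_continuous X Y g"
proof -
  have "{(x, x') \<in> points X \<times> points X. (f x, f x') \<in> E}
      = {(x, x') \<in> points X \<times> points X. (g x, g x') \<in> E}" for E
    using assms(2) by auto
  with assms show ?thesis
    unfolding unif_continuous_def by (auto simp: Pi_iff)
qed

lemma separated_initial_unif:
  assumes M: "\<And>i. i \<in> I \<Longrightarrow> uniform_structure (M i)" "\<And>i. i \<in> I \<Longrightarrow> separated (M i)"
    and p: "\<And>i x. i \<in> I \<Longrightarrow> x \<in> S \<Longrightarrow> p i x \<in> points (M i)"
    and inj: "\<And>x y. x \<in> S \<Longrightarrow> y \<in> S \<Longrightarrow> (\<And>i. i \<in> I \<Longrightarrow> p i x = p i y) \<Longrightarrow> x = y"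
  shows "separated (initial_unif S I M p)"
proof -
  let ?X = "initial_unif S I M p"
  have X: "uniform_structure ?X"
    using M(1) p by (rule uniform_initial_unif)
  have "x = y" if xy: "\<And>E. E \<in> entourages ?X \<Longrightarrow> (x, y) \<in> E" and S: "x \<in> S" "y \<in> S" for x y
  proof (rule inj[OF S])
    fix i assume i: "i \<in> I"
    have "(p i x, p i y) \<in> V" if "V \<in> entourages (M i)" for V
      using xy[OF entourage_initial_unifI[of "{i}" I "\<lambda>_. V" M S p]] i that by auto
    then have "(p i x, p i y) \<in> \<Inter>(entourages (M i))"
      by blast
    then show "p i x = p i y"
      using M(2)[OF i] unfolding separated_def by auto
  qed
  moreover have "S \<times> S \<in> entourages ?X"
    using entourage_UNIV[OF X] by simp
  ultimately have "\<Inter>(entourages ?X) \<subseteq> Id_on S"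
    by (intro subrelI) (metis Id_onI InterE SigmaD1 SigmaD2)
  moreover have "Id_on S \<subseteq> \<Inter>(entourages ?X)"
    using entourage_refl[OF X] by (auto simp: Id_on_def)
  ultimately show ?thesis
    unfolding separated_def points_initial_unif by (rule subset_antisym)
qed

text \<open>Seen as the initial uniformity of its two projections (\<open>True\<close> for the
  first, \<open>False\<close> for the second), the product inherits the uniform axioms,
  separatedness and its universal property from the general lemmas.\<close>

lemma unif_product_eq_initial:
  fixes A X :: "'u unif"
  assumes inf: "infinite (UNIV :: 'u set)" and A: "uniform_structure A" and X: "uniform_structure X"
  shows "unif_product A X = initial_unif (upair ` (points A \<times> points X)) UNIV
    (\<lambda>b. if b then A else X) (\<lambda>b q. if b then fst (unpair q) else snd (unpair q))"
    (is "_ = initial_unif ?P UNIV ?M ?p")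
proof (rule unif.equality)
  have unpair: "unpair (upair q) = q" for q :: "'u \<times> 'u"
    unfolding unpair_def using upair_inj[OF inf] by simp
  show "entourages (unif_product A X) = entourages (initial_unif ?P UNIV ?M ?p)"
  proof (intro subset_antisym subsetI)
    fix E assume "E \<in> entourages (unif_product A X)"
    then obtain U V where E: "E \<subseteq> ?P \<times> ?P" and UV: "U \<in> entourages A" "V \<in> entourages X"
      and UVE: "\<And>g g' x x'. (g, g') \<in> U \<Longrightarrow> (x, x') \<in> V \<Longrightarrow> (upair (g, x), upair (g', x')) \<in> E"
      by (fastforce simp: unif_product_def Let_def)
    have "{(q, q') \<in> ?P \<times> ?P. \<forall>b\<in>UNIV. (?p b q, ?p b q') \<in> (if b then U else V)} \<subseteq> E"
    proof clarify
      fix g x g' x' assume *: "\<forall>b\<in>UNIV. (?p b (upair (g, x)), ?p b (upair (g', x'))) \<in> (if b then U else V)"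
      show "(upair (g, x), upair (g', x')) \<in> E"
        using bspec[OF *, of True] bspec[OF *, of False] by (intro UVE) (simp_all add: unpair)
    qed
    with E UV show "E \<in> entourages (initial_unif ?P UNIV ?M ?p)"
      unfolding entourage_initial_unif
      by (intro conjI exI[of _ UNIV] exI[of _ "\<lambda>b. if b then U else V"]) auto
  next
    fix E assume "E \<in> entourages (initial_unif ?P UNIV ?M ?p)"
    then obtain K V where E: "E \<subseteq> ?P \<times> ?P" and V: "\<And>b. b \<in> K \<Longrightarrow> V b \<in> entourages (?M b)"
      and KE: "{(q, q') \<in> ?P \<times> ?P. \<forall>b\<in>K. (?p b q, ?p b q') \<in> V b} \<subseteq> E"
      unfolding entourage_initial_unif by blast
    \<comment> \<open>\<open>K\<close> may omit one of the two coordinates; the total entourage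
      stands in for it.\<close>
    define W where "W b = (if b \<in> K then V b else points (?M b) \<times> points (?M b))" for b
    have W: "W True \<in> entourages A" "W False \<in> entourages X"
      using V[of True] V[of False] entourage_UNIV[OF A] entourage_UNIV[OF X] by (auto simp: W_def)
    have "(upair (g, x), upair (g', x')) \<in> E" if "(g, g') \<in> W True" "(x, x') \<in> W False" for g g' x x'
    proof -
      have "g \<in> points A" "g' \<in> points A" "x \<in> points X" "x' \<in> points X"
        using that entourage_subset[OF A W(1)] entourage_subset[OF X W(2)] by auto
      moreover have "(?p b (upair (g, x)), ?p b (upair (g', x'))) \<in> V b" if "b \<in> K" for b
        using that \<open>(g, g') \<in> W True\<close> \<open>(x, x') \<in> W False\<close> by (cases b) (simp_all add: unpair W_def)
      ultimately show ?thesis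
        by (intro subsetD[OF KE]) auto
    qed
    then have "\<forall>(g, g')\<in>W True. \<forall>(x, x')\<in>W False. (upair (g, x), upair (g', x')) \<in> E"
      by blast
    with E W show "E \<in> entourages (unif_product A X)"
      unfolding unif_product_def Let_def by auto
  qed
qed (simp_all add: unif_product_def Let_def)

text \<open>The initial uniformity of the maps \<open>f i\<close> on representatives is the one the
  image inherits from the product, so the product itself is never formed. The points of the vertex
  stay inside \<open>A\<close>, which also settles their smallness.\<close>

lemma Unif_factorization:
  fixes A :: "'u set" and M :: "'i \<Rightarrow> 'u unif"
  assumes "small A"
    and M: "\<And>i. i \<in> I \<Longrightarrow> M i \<in> Ob Unif" and f: "\<And>i. i \<in> I \<Longrightarrow> f i \<in> A \<rightarrow> points (M i)"
  shows "\<exists>L e p. factorization (Ob Unif) points unif_continuous A I M f L e p"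
proof -
  define \<phi> where "\<phi> a = restrict (\<lambda>i. f i a) I" for a
  define e where "e a = inv_into A \<phi> (\<phi> a)" for a
  have e: "e x \<in> A" "\<phi> (e x) = \<phi> x" if "x \<in> A" for x
    using that unfolding e_def by (auto intro: inv_into_into f_inv_into_f)
  have fe: "f i (e x) = f i x" if "i \<in> I" "x \<in> A" for i x
    using fun_cong[OF e(2)[OF that(2)], of i] that(1) by (simp add: \<phi>_def)
  txt \<open>The image of \<open>A\<close> in the product is represented by \<open>e ` A\<close>, one element of each fibre of \<open>\<phi>\<close>.\<close>
  let ?L = "initial_unif (e ` A) I M f"
  have M': "uniform_structure (M i)" "separated (M i)" if "i \<in> I" for i
    using M[OF that] by (simp_all add: Unif_def concrete_cat_def)
  have f_pts: "f i x \<in> points (M i)" if "i \<in> I" "x \<in> e ` A" for i x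
    using f[OF that(1)] e(1) that(2) by auto
  have inj: "x = y" if "x \<in> e ` A" "y \<in> e ` A" "\<And>i. i \<in> I \<Longrightarrow> f i x = f i y" for x y
  proof -
    obtain a b where ab: "x = e a" "a \<in> A" "y = e b" "b \<in> A"
      using \<open>x \<in> e ` A\<close> \<open>y \<in> e ` A\<close> by blast
    then have "\<phi> a = \<phi> b"
      using that(3) fe by (auto simp: \<phi>_def fun_eq_iff)
    then show ?thesis
      using ab by (simp add: e_def)
  qed
  have L: "uniform_structure ?L" "separated ?L"
    using uniform_initial_unif[of I M "e ` A" f] separated_initial_unif[of I M "e ` A" f] M' f_pts inj
    by blast+
  have "factorization (Ob Unif) points unif_continuous A I M f ?L e f"
  proof
    show "?L \<in> Ob Unif"
      using L small_image[OF assms(1)] by (simp add: Unif_def concrete_cat_def)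
    show "unif_continuous ?L (M i) (f i)" if "i \<in> I" for i
      using that f_pts by (intro unif_continuous_initial_proj)
    show "unif_continuous Y ?L h"
      if "Y \<in> Ob Unif" "h \<in> points Y \<rightarrow> points ?L"
        "\<And>i. i \<in> I \<Longrightarrow> unif_continuous Y (M i) (\<lambda>y. f i (h y))" for Y h
      using that by (intro unif_continuous_initialI) (auto simp: Unif_def concrete_cat_def)
    \<comment> \<open>The points of the vertex are exactly the values of \<open>e\<close>, so
      \<open>e\<close> is epic already for plain functions.\<close>
    show "h x = k x" if "\<And>x. x \<in> A \<Longrightarrow> h (e x) = k (e x)" "x \<in> points ?L" for h k :: "'u \<Rightarrow> 'u" and x
      using that by auto
    show "\<exists>y\<in>points ?L. \<forall>i\<in>I. f i y = u i (f i x)"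
      if u: "\<And>x. x \<in> A \<Longrightarrow> \<exists>y\<in>A. \<forall>i\<in>I. u i (f i x) = f i y" and x: "x \<in> points ?L" for u x
    proof -
      have "x \<in> A"
        using x e(1) by auto
      then obtain y where "y \<in> A" "\<forall>i\<in>I. u i (f i x) = f i y"
        using u by blast
      then show ?thesis
        by (intro bexI[of _ "e y"]) (auto simp: fe)
    qed
  qed (use fe inj in auto)
  then show ?thesis
    by blast
qed

lemma Unif_algebras_cocomplete:
  fixes G :: "('u, 'b) monoid_scheme" and T :: "'u topology"
  assumes "universe TYPE('u)"
    and "topological_group G T" and "compact_space T" and "Hausdorff_space T"
    and "small (carrier G)"
  shows "small_cocomplete TYPE('u) (EM Unif (unif_monad G T))"
proof -
  have inf: "infinite (UNIV :: 'u set)"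
    using assms(1) by (simp add: universe_def)
  have unpair: "unpair (upair q) = q" for q :: "'u \<times> 'u"
    unfolding unpair_def using upair_inj[OF inf] by simp
  have G: "group G" "topspace T = carrier G"
    using assms(2) by (simp_all add: topological_group_def)
  define K where "K = compact_unif T"
  have K: "points K = carrier G" "uniform_structure K" "separated K"
    using compact_unif[OF assms(3,4)] G(2) by (simp_all add: K_def)
  have obs: "X \<in> Ob Unif \<longleftrightarrow> small (points X) \<and> uniform_structure X \<and> separated X" for X :: "'u unif"
    by (simp add: Unif_def concrete_cat_def)
  let ?p = "\<lambda>b q. if b then fst (unpair q) else snd (unpair q)"
  have prod: "unif_product K X = initial_unif (upair ` (carrier G \<times> points X)) UNIV
      (\<lambda>b. if b then K else X) ?p" if "X \<in> Ob Unif" for X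
    using that unif_product_eq_initial[OF inf K(2), of X] by (simp add: obs K(1))
  have fst: "unif_continuous (unif_product K X) K (\<lambda>q. fst (unpair q))"
    and snd: "unif_continuous (unif_product K X) X (\<lambda>q. snd (unpair q))" if "X \<in> Ob Unif" for X
    using unif_continuous_initial_proj[of True UNIV "upair ` (carrier G \<times> points X)" ?p "\<lambda>b. if b then K else X"]
      unif_continuous_initial_proj[of False UNIV "upair ` (carrier G \<times> points X)" ?p "\<lambda>b. if b then K else X"]
    by (fastforce simp: prod[OF that] unpair K(1))+
  \<comment> \<open>The universal property of the product. The slices and the maps required by
    \<open>mor_P\<close> are checked through it, one coordinate at a time.\<close>
  have into_product: "unif_continuous Y (unif_product K X) h"
    if "X \<in> Ob Unif" "uniform_structure Y" "h \<in> points Y \<rightarrow> upair ` (carrier G \<times> points X)"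
      "unif_continuous Y K (\<lambda>y. fst (unpair (h y)))" "unif_continuous Y X (\<lambda>y. snd (unpair (h y)))" for X Y h
    unfolding prod[OF that(1)] using that by (intro unif_continuous_initialI) auto
  have product_obs: "unif_product K X \<in> Ob Unif" if "X \<in> Ob Unif" for X
  proof -
    have "small (upair ` (carrier G \<times> points X))"
      using that assms by (intro small_upair_Sigma) (auto simp: obs)
    moreover have "uniform_structure (unif_product K X)"
      unfolding prod[OF that]
    proof (rule uniform_initial_unif)
      show "uniform_structure (if b then K else X)" for b
        using that K(2) by (simp add: obs)
      show "?p b q \<in> points (if b then K else X)" if "q \<in> upair ` (carrier G \<times> points X)" for b q
        using that by (auto simp: unpair K(1))
    qed
    moreover have "separated (unif_product K X)"
      unfolding prod[OF that]
    proof (rule separated_initial_unif)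
      fix q q' assume "q \<in> upair ` (carrier G \<times> points X)" "q' \<in> upair ` (carrier G \<times> points X)"
        and eq: "\<And>b. b \<in> UNIV \<Longrightarrow> ?p b q = ?p b q'"
      moreover have "unpair q = unpair q'"
        using eq[of True] eq[of False] by (simp add: prod_eq_iff)
      ultimately show "q = q'"
        using unpair by (metis imageE)
    next
      show "uniform_structure (if b then K else X)" "separated (if b then K else X)" for b
        using that K by (simp_all add: obs)
      show "?p b q \<in> points (if b then K else X)" if "q \<in> upair ` (carrier G \<times> points X)" for b q
        using that by (auto simp: unpair K(1))
    qed
    ultimately show ?thesis
      by (simp add: obs prod[OF that])
  qed
  have "action_category G (Ob Unif) points unif_continuous (unif_product K)"
  proof (intro action_category.intro action_category_axioms.intro)
    show "points (unif_product K X) = upair ` (carrier G \<times> points X)" if "X \<in> Ob Unif" for X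
      by (simp add: prod[OF that])
    show "unif_continuous X (unif_product K X) (\<lambda>x. upair (k, x))"
      if "X \<in> Ob Unif" "k \<in> carrier G" for X k
      using that K by (intro into_product)
        (auto simp: unpair obs intro: unif_continuous_const unif_continuous_id)
    show "unif_continuous (unif_product K X) (unif_product K Y)
        (\<lambda>q. case unpair q of (g, x) \<Rightarrow> upair (g, f x))"
      if X: "X \<in> Ob Unif" and Y: "Y \<in> Ob Unif" and f: "unif_continuous X Y f" for X Y f
    proof (rule into_product[OF Y])
      show "uniform_structure (unif_product K X)"
        using product_obs[OF X] by (simp add: obs)
      show "(\<lambda>q. case unpair q of (g, x) \<Rightarrow> upair (g, f x))
          \<in> points (unif_product K X) \<rightarrow> upair ` (carrier G \<times> points Y)"
        using f by (auto simp: prod[OF X] unpair unif_continuous_def)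
    qed (use fst[OF X] unif_continuous_compose[OF snd[OF X] f] in \<open>simp_all add: split_beta unpair\<close>)
    show "\<exists>L e p. factorization (Ob Unif) points unif_continuous A I M f L e p"
      if "small A" "\<And>i. i \<in> I \<Longrightarrow> M i \<in> Ob Unif" "\<And>i. i \<in> I \<Longrightarrow> f i \<in> A \<rightarrow> points (M i)"
      for A :: "'u set" and I :: "('u unif \<times> ('u \<Rightarrow> 'u) \<times> ('u \<Rightarrow> 'u)) set" and M f
      using that by (rule Unif_factorization)
    show "f x \<in> points Y" if "unif_continuous X Y f" "x \<in> points X" for X Y :: "'u unif" and f x
      using that by (auto simp: unif_continuous_def)
    show "unif_continuous X Y g"
      if "unif_continuous X Y f" "\<And>x. x \<in> points X \<Longrightarrow> f x = g x" for X Y :: "'u unif" and f g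
      using that by (rule unif_continuous_cong)
    show "unif_continuous X Z (\<lambda>x. g (f x))"
      if "unif_continuous X Y f" "unif_continuous Y Z g" for X Y Z :: "'u unif" and f g
      using that by (rule unif_continuous_compose)
  qed (use assms(1) G(1) product_obs in \<open>simp_all add: obs unif_continuous_id\<close>)
  from action_category.small_cocomplete_EM[OF this] show ?thesis
    by (simp add: unif_monad_def K_def Unif_def concrete_cat_def)
qed

theorem proposition5:
  fixes G :: "('u, 'b) monoid_scheme" and T :: "'u topology"
  assumes "universe TYPE('u)"
    and "topological_group G T" and "compact_space T" and "Hausdorff_space T"
    and "small (carrier G)"
  shows "small_cocomplete TYPE('u) (EM Tych (top_monad G T)) \<and>
         small_cocomplete TYPE('u) (EM Unif (unif_monad G T)) \<and>
         small_cocomplete TYPE('u) (EM Comp (top_monad G T))"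
  using Tych_algebras_cocomplete[OF assms] Unif_algebras_cocomplete[OF assms]
    Comp_algebras_cocomplete[OF assms] by blast

end
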